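(* Let ALG be a $\beta$-approximation for the $\{0,L\}$-capacitated $k$-center. Then the following algorithm (Algorithm 1) is a $\max\{7,\beta\}$-approximation for the $\{0,L\}$-capacitated conservative $\alpha$-fault-tolerant $k$-center. Input: a connected unweighted graph $G=(V,E)$, $k$, the set $V^L$ of vertices of capacity $L$, and $\alpha$. (1) Let $A$ be a maximal $7$-independent vertex set in $G$. (2) For each $a\in A$, let $B(a)$ be $\alpha$ vertices chosen arbitrarily in $N(a)\cap V^L$. (3) Let $B=\bigcup_{a\in A}B(a)$. (4) If ALG$(G,k-|B|,V^L\setminus B)$ returns failure, return failure; otherwise, letting $(S,\phi)$ be the solution it returns, return $(S\cup B,\phi)$.
   Context: Distances are shortest-path distances $d$ in an unweighted connected graph $G=(V,E)$; $N(a)=\{v:d(a,v)\le1\}$; a set $A$ is $7$-independent if any two distinct vertices of $A$ are at distance at least $7$. In the $\{0,L\}$-capacitated setting every vertex has capacity $0$ or $L$ for a fixed $L$, and $V^L$ denotes the set of vertices of capacity $L$. A distance-$r$ solution for the $\{0,L\}$-capacitated $k$-center instance $(G,k,V^L)$ is a set $S$ of at most $k$ centers and an assignment $\phi:V\to S$ with $d(u,\phi(u))\le r$ and $|\phi^{-1}(v)|\le L$ for $v\in S\cap V^L$, $|\phi^{-1}(v)|=0$ for $v\in S\setminus V^L$. A distance-$r$ solution for the conservative $\alpha$-fault-tolerant instance $(G,k,V^L,\alpha)$ is a pair $(S,\phi_0)$ with $|S|\le k$ and $\phi_0$ a distance-$r$ capacity-respecting assignment to $S$, such that for every $F\subseteq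 S$ with $|F|\le\alpha$ there is a capacity-respecting assignment $\phi_F:V\to S\setminus F$ with $d(u,\phi_F(u))\le r$ for all $u$ and $\phi_F(u)=\phi_0(u)$ whenever $\phi_0(u)\notin F$. An algorithm is a $\rho$-approximation (in this unweighted formulation) if it runs in polynomial time and either returns failure, which it does only when no distance-$1$ solution exists, or returns a distance-$\rho$ solution; via the standard threshold-graph (bottleneck) reduction and reduction to connected components, this yields a $\rho$-approximation for arbitrary metrics. *)

theory Defs
  imports Complex_Main "HOL-Computational_Algebra.Polynomial"
begin

section \<open>Graphs\<close>

text \<open>A simple graph is a finite nonempty vertex set together with its adjacency relation.\<close>

definition simple_graph :: "'a set \<Rightarrow> ('a \<times> 'a) set \<Rightarrow> bool" where
  "simple_graph V E \<longleftrightarrow> finite V \<and> V \<noteq> {} \<and> E \<subseteq> V \<times> V \<and> sym E \<and> irrefl E"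

definition connected_graph :: "'a set \<Rightarrow> ('a \<times> 'a) set \<Rightarrow> bool" where
  "connected_graph V E \<longleftrightarrow> simple_graph V E \<and> (\<forall>u\<in>V. \<forall>v\<in>V. (u, v) \<in> E\<^sup>*)"

text \<open>\<open>(u, v) \<in> E ^^ m\<close> says that there is a walk of length \<open>m\<close> from \<open>u\<close> to \<open>v\<close>. The
  value is meaningful only for vertices of the same component; it is used for connected graphs.\<close>

definition gdist :: "('a \<times> 'a) set \<Rightarrow> 'a \<Rightarrow> 'a \<Rightarrow> nat" where
  "gdist E u v = (LEAST m. (u, v) \<in> E ^^ m)"

definition nbhd :: "'a set \<Rightarrow> ('a \<times> 'a) set \<Rightarrow> 'a \<Rightarrow> 'a set" where
  "nbhd V E a = {v \<in> V. gdist E a v \<le> 1}"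

definition dist_independent :: "('a \<times> 'a) set \<Rightarrow> nat \<Rightarrow> 'a set \<Rightarrow> bool" where
  "dist_independent E r A \<longleftrightarrow> (\<forall>a\<in>A. \<forall>b\<in>A. a \<noteq> b \<longrightarrow> r \<le> gdist E a b)"

definition maximal_dist_independent ::
  "'a set \<Rightarrow> ('a \<times> 'a) set \<Rightarrow> nat \<Rightarrow> 'a set \<Rightarrow> bool" where
  "maximal_dist_independent V E r A \<longleftrightarrow>
     A \<subseteq> V \<and> dist_independent E r A \<and>
     (\<forall>A'. A \<subset> A' \<and> A' \<subseteq> V \<longrightarrow> \<not> dist_independent E r A')"


section \<open>Capacitated and fault-tolerant k-center\<close>

text \<open>\<open>VL\<close> is the set of vertices of capacity \<open>L\<close>; all other vertices have capacity 0. Only the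
  values of assignments on \<open>V\<close> matter.\<close>

definition cap_assignment ::
  "'a set \<Rightarrow> ('a \<times> 'a) set \<Rightarrow> nat \<Rightarrow> 'a set \<Rightarrow> real \<Rightarrow> 'a set \<Rightarrow> ('a \<Rightarrow> 'a) \<Rightarrow> bool" where
  "cap_assignment V E L VL r S \<phi> \<longleftrightarrow>
     (\<forall>u\<in>V. \<phi> u \<in> S \<and> real (gdist E u (\<phi> u)) \<le> r) \<and>
     (\<forall>v \<in> S \<inter> VL. card {u \<in> V. \<phi> u = v} \<le> L) \<and>
     (\<forall>v \<in> S - VL. card {u \<in> V. \<phi> u = v} = 0)"

definition cap_solution ::
  "'a set \<Rightarrow> ('a \<times> 'a) set \<Rightarrow> nat \<Rightarrow> nat \<Rightarrow> 'a set \<Rightarrow> real \<Rightarrow> 'a set \<Rightarrow> ('a \<Rightarrow> 'a) \<Rightarrow> bool" where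
  "cap_solution V E L k VL r S \<phi> \<longleftrightarrow>
     S \<subseteq> V \<and> card S \<le> k \<and> cap_assignment V E L VL r S \<phi>"

definition ft_solution ::
  "'a set \<Rightarrow> ('a \<times> 'a) set \<Rightarrow> nat \<Rightarrow> nat \<Rightarrow> 'a set \<Rightarrow> nat \<Rightarrow> real \<Rightarrow> 'a set \<Rightarrow> ('a \<Rightarrow> 'a) \<Rightarrow> bool"
  where
  "ft_solution V E L k VL \<alpha> r S \<phi>0 \<longleftrightarrow>
     S \<subseteq> V \<and> card S \<le> k \<and> cap_assignment V E L VL r S \<phi>0 \<and>
     (\<forall>F. F \<subseteq> S \<and> card F \<le> \<alpha> \<longrightarrow>
        (\<exists>\<phi>F. cap_assignment V E L VL r (S - F) \<phi>F \<and>
              (\<forall>u\<in>V. \<phi>0 u \<notin> F \<longrightarrow> \<phi>F u = \<phi>0 u)))"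


section \<open>Programs and running time\<close>

text \<open>The model of computation is N. D. Jones's WHILE language on binary trees (Computability and
  Complexity from a Programming Perspective, MIT Press 1997). Every executed assignment, test
  and call costs one unit. This is a realistic cost: \<open>ENode\<close> builds one cell from two pointers,
  tests only compare with \<open>Leaf\<close>, and a fixed program contains only finitely many expressions.
  The polynomial-time decidable languages of this model are those of Turing machines.
  \<open>Call x c e\<close> runs \<open>c\<close> in a fresh store, so it is a non-recursive subroutine and could be
  replaced by an inlined copy of \<open>c\<close> with renamed variables.\<close>

datatype tree = Leaf | Node tree tree

fun left :: "tree \<Rightarrow> tree" where
  "left Leaf = Leaf"
| "left (Node l r) = l"

fun right :: "tree \<Rightarrow> tree" where
  "right Leaf = Leaf"
| "right (Node l r) = r"

datatype expr = EVar nat | ELeaf | ENode expr expr | ELeft expr | ERight expr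

type_synonym store = "nat \<Rightarrow> tree"

primrec eval_expr :: "expr \<Rightarrow> store \<Rightarrow> tree" where
  "eval_expr (EVar x) s = s x"
| "eval_expr ELeaf s = Leaf"
| "eval_expr (ENode e1 e2) s = Node (eval_expr e1 s) (eval_expr e2 s)"
| "eval_expr (ELeft e) s = left (eval_expr e s)"
| "eval_expr (ERight e) s = right (eval_expr e s)"

datatype com =
    Skip
  | Assign nat expr
  | Seq com com
  | Cond expr com com
  | While expr com
  | Call nat com expr

definition init_store :: "tree \<Rightarrow> store" where
  "init_store x = (\<lambda>_. Leaf)(0 := x)"

text \<open>\<open>exec c s t s'\<close>: started in store \<open>s\<close>, the program \<open>c\<close> halts after \<open>t\<close> steps in store \<open>s'\<close>.\<close>

inductive exec :: "com \<Rightarrow> store \<Rightarrow> nat \<Rightarrow> store \<Rightarrow> bool" where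
  Skip: "exec Skip s 1 s"
| Assign: "exec (Assign x e) s 1 (s(x := eval_expr e s))"
| Seq: "exec c1 s t1 s1 \<Longrightarrow> exec c2 s1 t2 s2 \<Longrightarrow> exec (Seq c1 c2) s (t1 + t2) s2"
| CondTrue: "eval_expr b s \<noteq> Leaf \<Longrightarrow> exec c1 s t s' \<Longrightarrow> exec (Cond b c1 c2) s (t + 1) s'"
| CondFalse: "eval_expr b s = Leaf \<Longrightarrow> exec c2 s t s' \<Longrightarrow> exec (Cond b c1 c2) s (t + 1) s'"
| WhileFalse: "eval_expr b s = Leaf \<Longrightarrow> exec (While b c) s 1 s"
| WhileTrue: "eval_expr b s \<noteq> Leaf \<Longrightarrow> exec c s t1 s1 \<Longrightarrow> exec (While b c) s1 t2 s2 \<Longrightarrow>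
    exec (While b c) s (t1 + t2 + 1) s2"
| Call: "exec c (init_store (eval_expr e s)) t s' \<Longrightarrow>
    exec (Call x c e) s (t + 1) (s(x := s' 0))"

inductive_cases exec_SkipE: "exec Skip s t s'"
inductive_cases exec_AssignE: "exec (Assign x e) s t s'"
inductive_cases exec_SeqE: "exec (Seq c1 c2) s t s'"
inductive_cases exec_CondE: "exec (Cond b c1 c2) s t s'"
inductive_cases exec_WhileE: "exec (While b c) s t s'"
inductive_cases exec_CallE: "exec (Call x c e) s t s'"

definition run :: "com \<Rightarrow> tree \<Rightarrow> nat \<Rightarrow> tree \<Rightarrow> bool" where
  "run P x t y \<longleftrightarrow> (\<exists>s'. exec P (init_store x) t s' \<and> s' 0 = y)"

lemma exec_deterministic:
  "exec c s t s' \<Longrightarrow> exec c s u s'' \<Longrightarrow> u = t \<and> s'' = s'"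
proof (induction arbitrary: u s'' rule: exec.induct)
  case (Seq c1 s t1 s1 c2 t2 s2)
  from Seq.prems show ?case
  proof (rule exec_SeqE)
    fix r1 q r2
    assume u: "u = r1 + r2" and 1: "exec c1 s r1 q" and 2: "exec c2 q r2 s''"
    from Seq.IH(1)[OF 1] have e: "r1 = t1" "q = s1" by simp_all
    from Seq.IH(2)[OF 2[unfolded e(2)]] show ?thesis by (simp add: u e(1))
  qed
next
  case (WhileTrue b s c t1 s1 t2 s2)
  from WhileTrue.prems show ?case
  proof (rule exec_WhileE)
    fix r1 q r2
    assume u: "u = Suc (r1 + r2)" and 1: "exec c s r1 q" and 2: "exec (While b c) q r2 s''"
    from WhileTrue.IH(1)[OF 1] have e: "r1 = t1" "q = s1" by simp_all
    from WhileTrue.IH(2)[OF 2[unfolded e(2)]] show ?thesis by (simp add: u e(1))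
  qed (use WhileTrue.hyps in simp_all)
next
  case (CondTrue b s c1 t s' c2)
  from CondTrue.prems show ?case
    by (rule exec_CondE) (use CondTrue.hyps in \<open>auto dest: CondTrue.IH\<close>)
next
  case (CondFalse b s c2 t s' c1)
  from CondFalse.prems show ?case
    by (rule exec_CondE) (use CondFalse.hyps in \<open>auto dest: CondFalse.IH\<close>)
next
  case (WhileFalse b s c)
  from WhileFalse.prems show ?case
    by (rule exec_WhileE) (use WhileFalse.hyps in auto)
next
  case (Call c e s t s' x)
  from Call.prems show ?case by (rule exec_CallE) (auto dest: Call.IH)
qed (auto elim: exec_SkipE exec_AssignE)

lemma run_deterministic: "run P x t y \<Longrightarrow> run P x u z \<Longrightarrow> u = t \<and> z = y"
  unfolding run_def using exec_deterministic by blast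

text \<open>\<open>X\<close> is the set of admissible inputs; \<open>size x\<close> is the number of inner nodes of \<open>x\<close>.\<close>

definition polynomial_time :: "com \<Rightarrow> tree set \<Rightarrow> bool" where
  "polynomial_time P X \<longleftrightarrow>
     (\<exists>p :: nat poly. \<forall>x\<in>X. \<exists>t y. run P x t y \<and> t \<le> poly p (size x))"


section \<open>Encoding of instances and results\<close>

text \<open>Programs work on graphs with vertex set \<open>{..<n}\<close>. Numbers are encoded in binary, least
  significant bit first; vertex sets by characteristic vectors; graphs by adjacency matrices.\<close>

definition enc_bool :: "bool \<Rightarrow> tree" where
  "enc_bool b = (if b then Node Leaf Leaf else Leaf)"

definition enc_list :: "('b \<Rightarrow> tree) \<Rightarrow> 'b list \<Rightarrow> tree" where
  "enc_list f xs = foldr (\<lambda>x t. Node (f x) t) xs Leaf"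

fun enc_nat :: "nat \<Rightarrow> tree" where
  "enc_nat m = (if m = 0 then Leaf else Node (enc_bool (odd m)) (enc_nat (m div 2)))"

declare enc_nat.simps [simp del]

definition enc_set :: "nat \<Rightarrow> nat set \<Rightarrow> tree" where
  "enc_set n X = enc_list (\<lambda>i. enc_bool (i \<in> X)) [0..<n]"

definition enc_graph :: "nat \<Rightarrow> (nat \<times> nat) set \<Rightarrow> tree" where
  "enc_graph n E = enc_list (\<lambda>i. enc_set n (E `` {i})) [0..<n]"

definition enc_cap_instance :: "nat \<Rightarrow> (nat \<times> nat) set \<Rightarrow> nat \<Rightarrow> nat set \<Rightarrow> tree" where
  "enc_cap_instance n E k VL = Node (enc_graph n E) (Node (enc_nat k) (enc_set n VL))"

definition enc_ft_instance :: "nat \<Rightarrow> (nat \<times> nat) set \<Rightarrow> nat \<Rightarrow> nat set \<Rightarrow> nat \<Rightarrow> tree" where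
  "enc_ft_instance n E k VL \<alpha> =
     Node (enc_graph n E) (Node (enc_nat k) (Node (enc_set n VL) (enc_nat \<alpha>)))"

text \<open>\<open>None\<close> stands for failure.\<close>

type_synonym result = "(nat set \<times> (nat \<Rightarrow> nat)) option"

definition enc_result :: "nat \<Rightarrow> result \<Rightarrow> tree" where
  "enc_result n res = (case res of
       None \<Rightarrow> Leaf
     | Some (S, \<phi>) \<Rightarrow> Node (enc_set n S) (enc_list (\<lambda>u. enc_nat (\<phi> u)) [0..<n]))"

text \<open>The encoding of a result depends only on \<open>S \<inter> {..<n}\<close>, hence the condition on \<open>S\<close>.\<close>

definition returns :: "com \<Rightarrow> tree \<Rightarrow> nat \<Rightarrow> result \<Rightarrow> bool" where
  "returns P x n res \<longleftrightarrow>
     (\<exists>t. run P x t (enc_result n res)) \<and>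
     (case res of None \<Rightarrow> True | Some (S, \<phi>) \<Rightarrow> S \<subseteq> {..<n})"

definition valid_instance :: "nat \<Rightarrow> (nat \<times> nat) set \<Rightarrow> nat set \<Rightarrow> bool" where
  "valid_instance n E VL \<longleftrightarrow> connected_graph {..<n} E \<and> VL \<subseteq> {..<n}"

definition cap_inputs :: "tree set" where
  "cap_inputs = {enc_cap_instance n E k VL | n E k VL. valid_instance n E VL}"

definition ft_inputs :: "tree set" where
  "ft_inputs = {enc_ft_instance n E k VL \<alpha> | n E k VL \<alpha>. valid_instance n E VL}"


section \<open>Approximation algorithms\<close>

definition cap_approximation :: "nat \<Rightarrow> real \<Rightarrow> com \<Rightarrow> bool" where
  "cap_approximation L \<rho> P \<longleftrightarrow>
     polynomial_time P cap_inputs \<and>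
     (\<forall>n E k VL. valid_instance n E VL \<longrightarrow>
        (\<exists>res. returns P (enc_cap_instance n E k VL) n res \<and>
           (case res of
              None \<Rightarrow> \<not> (\<exists>S \<phi>. cap_solution {..<n} E L k VL 1 S \<phi>)
            | Some (S, \<phi>) \<Rightarrow> cap_solution {..<n} E L k VL \<rho> S \<phi>)))"

definition ft_approximation :: "nat \<Rightarrow> real \<Rightarrow> com \<Rightarrow> bool" where
  "ft_approximation L \<rho> P \<longleftrightarrow>
     polynomial_time P ft_inputs \<and>
     (\<forall>n E k VL \<alpha>. valid_instance n E VL \<longrightarrow>
        (\<exists>res. returns P (enc_ft_instance n E k VL \<alpha>) n res \<and>
           (case res of
              None \<Rightarrow> \<not> (\<exists>S \<phi>. ft_solution {..<n} E L k VL \<alpha> 1 S \<phi>)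
            | Some (S, \<phi>) \<Rightarrow> ft_solution {..<n} E L k VL \<alpha> \<rho> S \<phi>)))"


section \<open>The algorithm\<close>

text \<open>\<open>algorithm1 ALG n E k VL \<alpha> out\<close>: \<open>out\<close> is a possible result for some way of making the
  arbitrary choices of \<open>A\<close> and of the sets \<open>Bf a\<close>. If some \<open>Bf a\<close> cannot be chosen because there
  are fewer than \<open>\<alpha>\<close> candidates, the result is failure. If \<open>card B > k\<close>, the truncated
  subtraction calls \<open>ALG\<close> with budget 0, for which, as for a negative budget, there is no
  solution at any distance.\<close>

definition algorithm1 ::
  "com \<Rightarrow> nat \<Rightarrow> (nat \<times> nat) set \<Rightarrow> nat \<Rightarrow> nat set \<Rightarrow> nat \<Rightarrow> result \<Rightarrow> bool" where
  "algorithm1 ALG n E k VL \<alpha> out \<longleftrightarrow>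
     (\<exists>A. maximal_dist_independent {..<n} E 7 A \<and>
        (if \<exists>a\<in>A. card (nbhd {..<n} E a \<inter> VL) < \<alpha> then out = None
         else \<exists>Bf B res.
           (\<forall>a\<in>A. Bf a \<subseteq> nbhd {..<n} E a \<inter> VL \<and> card (Bf a) = \<alpha>) \<and>
           B = (\<Union>a\<in>A. Bf a) \<and>
           returns ALG (enc_cap_instance n E (k - card B) (VL - B)) n res \<and>
           out = (case res of None \<Rightarrow> None | Some (S, \<phi>) \<Rightarrow> Some (S \<union> B, \<phi>))))"

definition implements_algorithm1 :: "com \<Rightarrow> com \<Rightarrow> bool" where
  "implements_algorithm1 ALG P \<longleftrightarrow>
     (\<forall>n E k VL \<alpha>. valid_instance n E VL \<longrightarrow>
        (\<exists>out. returns P (enc_ft_instance n E k VL \<alpha>) n out \<and> algorithm1 ALG n E k VL \<alpha> out))"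

end

theory Submission
  imports Defs
begin

text \<open>Fault tolerance forces every closed neighbourhood \<open>N(a)\<close> to contain more than \<open>\<alpha>\<close> centers of
  capacity \<open>L\<close>. Given a distance-1 solution, let \<open>\<alpha>\<close> centers in each \<open>N(a)\<close>, \<open>a \<in> A\<close>, fail, among
  them those of \<open>B(a)\<close>. The clients that move lie within distance 2 of \<open>a\<close> and move to centers within
  distance 3 of \<open>a\<close>, so the repairs for different \<open>a\<close> do not interact, since \<open>A\<close> is 7-independent.
  Doing them all leaves a distance-1 solution with budget \<open>k - |B|\<close> that avoids \<open>B\<close>, so the call of
  ALG may fail only if there is no distance-1 solution. Conversely, every vertex \<open>u\<close> is within distance
  6 of some \<open>a(u) \<in> A\<close> by maximality. If \<open>F\<close> fails, inject \<open>F - B\<close> into \<open>B(a) - F\<close> for each \<open>a\<close>; the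
  client \<open>u\<close> of a failed center moves to the image of that center in \<open>B(a(u))\<close>, at distance at most 7,
  and each backup center inherits clients of a single failed center.

  Polynomial-time programs are obtained from a function algebra on trees, closed under composition,
  case distinction and loops along the right spine of a tree.\<close>

section \<open>Polynomial-time tree functions\<close>

lemma poly_mono_nat: "m \<le> n \<Longrightarrow> poly (p :: nat poly) m \<le> poly p n"
  by (induction p) (auto intro!: add_mono mult_mono)

text \<open>The size of the result needs its own bound: \<open>ENode\<close> shares its arguments, so \<open>t\<close> steps can
  build a tree of size exponential in \<open>t\<close>.\<close>

definition ptime :: "(tree \<Rightarrow> tree) \<Rightarrow> bool" where
  "ptime f \<longleftrightarrow> (\<exists>c p. \<forall>x. (\<exists>t. run c x t (f x) \<and> t \<le> poly p (size x)) \<and> size (f x) \<le> poly p (size x))"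

lemma ptimeI:
  assumes "\<And>x. \<exists>t. run c x t (f x) \<and> t \<le> poly p (size x)" and "\<And>x. size (f x) \<le> poly q (size x)"
  shows "ptime f"
  unfolding ptime_def
proof (rule exI[of _ c], rule exI[of _ "p + q"], intro allI conjI)
  fix x
  show "\<exists>t. run c x t (f x) \<and> t \<le> poly (p + q) (size x)"
    using assms(1)[of x] by (auto intro: trans_le_add1)
  show "size (f x) \<le> poly (p + q) (size x)"
    using assms(2)[of x] by simp
qed

lemma exec_Call_run: "run c (eval_expr e s) t y \<Longrightarrow> exec (Call x c e) s (t + 1) (s(x := y))"
  unfolding run_def by (auto dest: exec.Call[where x = x])

lemma init_store_apply [simp]: "init_store x 0 = x" "init_store x (Suc i) = Leaf"
  by (simp_all add: init_store_def)

lemma ptime_expr: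
  assumes "\<And>x. size (f x) \<le> poly p (size x)" and "\<And>x. eval_expr e (init_store x) = f x"
  shows "ptime f"
proof (rule ptimeI[where c = "Assign 0 e" and p = "[:1:]"])
  fix x
  have "run (Assign 0 e) x 1 (f x)"
    unfolding run_def using exec.Assign[of 0 e "init_store x"] assms(2)[of x] by auto
  then show "\<exists>t. run (Assign 0 e) x t (f x) \<and> t \<le> poly [:1:] (size x)" by auto
qed (rule assms(1))

lemma ptime_id: "ptime (\<lambda>x. x)"
  by (rule ptime_expr[where p = "[:0, 1:]" and e = "EVar 0"]) auto

lemma ptime_Leaf: "ptime (\<lambda>x. Leaf)"
  by (rule ptime_expr[where p = 0 and e = ELeaf]) auto

lemma size_left: "size (left t) \<le> size t" and size_right: "size (right t) \<le> size t"
  by (cases t; simp)+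

text \<open>The time bound of \<open>g\<close> is evaluated at \<open>size (f x)\<close>, which only
  the size bound in \<open>ptime\<close> controls; hence the composed polynomial.\<close>

lemma ptime_comp:
  assumes "ptime g" "ptime f"
  shows "ptime (\<lambda>x. g (f x))"
proof -
  obtain cf pf where f: "\<And>x. \<exists>t. run cf x t (f x) \<and> t \<le> poly pf (size x)" "\<And>x. size (f x) \<le> poly pf (size x)"
    using assms(2) unfolding ptime_def by blast
  obtain cg pg where g: "\<And>x. \<exists>t. run cg x t (g x) \<and> t \<le> poly pg (size x)" "\<And>x. size (g x) \<le> poly pg (size x)"
    using assms(1) unfolding ptime_def by blast
  let ?c = "Seq (Call 0 cf (EVar 0)) (Call 0 cg (EVar 0))"
  show ?thesis
  proof (rule ptimeI)
    fix x
    obtain t where t: "run cf x t (f x)" "t \<le> poly pf (size x)" using f by blast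
    obtain u where u: "run cg (f x) u (g (f x))" "u \<le> poly pg (size (f x))" using g by blast
    have 1: "exec (Call 0 cf (EVar 0)) (init_store x) (t + 1) ((init_store x)(0 := f x))"
      by (rule exec_Call_run) (simp add: t)
    have 2: "exec (Call 0 cg (EVar 0)) ((init_store x)(0 := f x)) (u + 1)
        ((init_store x)(0 := f x, 0 := g (f x)))"
      by (rule exec_Call_run) (simp add: u)
    have "run ?c x (t + 1 + (u + 1)) (g (f x))"
      unfolding run_def using exec.Seq[OF 1 2] by auto
    moreover have "u \<le> poly pg (poly pf (size x))"
      using u(2) poly_mono_nat[OF f(2)[of x], of pg] by linarith
    ultimately show "\<exists>t. run ?c x t (g (f x)) \<and> t \<le> poly (pf + pcompose pg pf + [:2:]) (size x)"
      using t(2) by (intro exI conjI) (auto simp: poly_pcompose)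
    show "size (g (f x)) \<le> poly (pcompose pg pf) (size x)"
      using g(2)[of "f x"] poly_mono_nat[OF f(2)[of x], of pg] by (simp add: poly_pcompose)
  qed
qed

lemma ptime_left: "ptime f \<Longrightarrow> ptime (\<lambda>x. left (f x))"
  by (rule ptime_comp[OF ptime_expr[where p = "[:0, 1:]" and e = "ELeft (EVar 0)"]])
     (auto simp: size_left)

lemma ptime_right: "ptime f \<Longrightarrow> ptime (\<lambda>x. right (f x))"
  by (rule ptime_comp[OF ptime_expr[where p = "[:0, 1:]" and e = "ERight (EVar 0)"]])
     (auto simp: size_right)

lemma ptime_Node:
  assumes "ptime f" "ptime g"
  shows "ptime (\<lambda>x. Node (f x) (g x))"
proof -
  obtain cf pf where f: "\<And>x. \<exists>t. run cf x t (f x) \<and> t \<le> poly pf (size x)" "\<And>x. size (f x) \<le> poly pf (size x)"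
    using assms(1) unfolding ptime_def by blast
  obtain cg pg where g: "\<And>x. \<exists>t. run cg x t (g x) \<and> t \<le> poly pg (size x)" "\<And>x. size (g x) \<le> poly pg (size x)"
    using assms(2) unfolding ptime_def by blast
  let ?c = "Seq (Call 1 cf (EVar 0)) (Seq (Call 2 cg (EVar 0)) (Assign 0 (ENode (EVar 1) (EVar 2))))"
  show ?thesis
  proof (rule ptimeI)
    fix x
    obtain t where t: "run cf x t (f x)" "t \<le> poly pf (size x)" using f by blast
    obtain u where u: "run cg x u (g x)" "u \<le> poly pg (size x)" using g by blast
    let ?s = "init_store x"
    have 1: "exec (Call 1 cf (EVar 0)) ?s (t + 1) (?s(1 := f x))"
      by (rule exec_Call_run) (simp add: t)
    have 2: "exec (Call 2 cg (EVar 0)) (?s(1 := f x)) (u + 1) (?s(1 := f x, 2 := g x))"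
      by (rule exec_Call_run) (simp add: u)
    have "run ?c x (t + 1 + (u + 1 + 1)) (Node (f x) (g x))"
      unfolding run_def using exec.Seq[OF 1 exec.Seq[OF 2 exec.Assign]] by fastforce
    then show "\<exists>t. run ?c x t (Node (f x) (g x)) \<and> t \<le> poly (pf + pg + [:3:]) (size x)"
      using t(2) u(2) by (intro exI conjI) auto
    show "size (Node (f x) (g x)) \<le> poly (pf + pg + [:1:]) (size x)"
      using f(2)[of x] g(2)[of x] by simp
  qed
qed

lemma ptime_if:
  assumes "ptime b" "ptime f" "ptime g"
  shows "ptime (\<lambda>x. if b x = Leaf then f x else g x)"
proof -
  obtain cb pb where b: "\<And>x. \<exists>t. run cb x t (b x) \<and> t \<le> poly pb (size x)" "\<And>x. size (b x) \<le> poly pb (size x)"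
    using assms(1) unfolding ptime_def by blast
  obtain cf pf where f: "\<And>x. \<exists>t. run cf x t (f x) \<and> t \<le> poly pf (size x)" "\<And>x. size (f x) \<le> poly pf (size x)"
    using assms(2) unfolding ptime_def by blast
  obtain cg pg where g: "\<And>x. \<exists>t. run cg x t (g x) \<and> t \<le> poly pg (size x)" "\<And>x. size (g x) \<le> poly pg (size x)"
    using assms(3) unfolding ptime_def by blast
  \<comment> \<open>\<open>Cond\<close> takes its first branch on a tree other than
    \<open>Leaf\<close>, so \<open>cg\<close> comes before \<open>cf\<close>.\<close>
  let ?c = "Seq (Call 1 cb (EVar 0)) (Cond (EVar 1) (Call 0 cg (EVar 0)) (Call 0 cf (EVar 0)))"
  show ?thesis
  proof (rule ptimeI)
    fix x
    obtain r where r: "run cb x r (b x)" "r \<le> poly pb (size x)" using b by blast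
    obtain t where t: "run cf x t (f x)" "t \<le> poly pf (size x)" using f by blast
    obtain u where u: "run cg x u (g x)" "u \<le> poly pg (size x)" using g by blast
    let ?s = "init_store x"
    have 1: "exec (Call 1 cb (EVar 0)) ?s (r + 1) (?s(1 := b x))"
      by (rule exec_Call_run) (simp add: r)
    have 2: "exec (Call 0 cf (EVar 0)) (?s(1 := b x)) (t + 1) (?s(1 := b x, 0 := f x))"
      by (rule exec_Call_run) (simp add: t)
    have 3: "exec (Call 0 cg (EVar 0)) (?s(1 := b x)) (u + 1) (?s(1 := b x, 0 := g x))"
      by (rule exec_Call_run) (simp add: u)
    show "\<exists>t. run ?c x t (if b x = Leaf then f x else g x) \<and> t \<le> poly (pb + pf + pg + [:3:]) (size x)"
    proof (cases "b x = Leaf")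
      case True
      have "run ?c x (r + 1 + (t + 1 + 1)) (f x)"
        unfolding run_def using exec.Seq[OF 1 exec.CondFalse[OF _ 2, of "EVar 1"]] True by fastforce
      with True r t u show ?thesis by (intro exI conjI) auto
    next
      case False
      have "run ?c x (r + 1 + (u + 1 + 1)) (g x)"
        unfolding run_def using exec.Seq[OF 1 exec.CondTrue[OF _ 3, of "EVar 1"]] False by fastforce
      with False r t u show ?thesis by (intro exI conjI) auto
    qed
    show "size (if b x = Leaf then f x else g x) \<le> poly (pf + pg) (size x)"
      using f(2)[of x] g(2)[of x] by simp
  qed
qed

section \<open>Loops along the right spine of a tree\<close>

fun loopt :: "(tree \<Rightarrow> tree \<Rightarrow> tree) \<Rightarrow> tree \<Rightarrow> tree \<Rightarrow> tree" where
  "loopt g Leaf a = a"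
| "loopt g (Node l r) a = loopt g r (g (Node l r) a)"

text \<open>Variable 0 holds the parameter, 1 the remaining tree, 2 the accumulator. The measure
  \<open>\<mu>\<close> dominates the size of the accumulator and rises by at most \<open>Q\<close>
  in a round, and \<open>size u\<close> bounds the number of rounds. So
  \<open>\<mu> a + size u * Q \<le> M\<close> is an invariant that keeps every accumulator below
  \<open>M\<close>; a round costs its call plus 3 steps.\<close>

lemma exec_loop:
  assumes run: "\<And>w a. \<exists>t. run c (Node x (Node w a)) t (g w a) \<and> t \<le> poly p (size x + size w + size a + 2)"
    and growth: "\<And>w a. size w \<le> N \<Longrightarrow> \<mu> (g w a) \<le> \<mu> a + (Q :: nat)"
    and size: "\<And>a. size a \<le> \<mu> a"
  shows "s 0 = x \<Longrightarrow> s 1 = u \<Longrightarrow> s 2 = a \<Longrightarrow> size u \<le> N \<Longrightarrow> \<mu> a + size u * Q \<le> M \<Longrightarrow>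
    \<exists>t s'. exec (While (EVar 1) (Seq (Call 2 c (ENode (EVar 0) (ENode (EVar 1) (EVar 2))))
                                   (Assign 1 (ERight (EVar 1))))) s t s' \<and>
      s' 2 = loopt g u a \<and> \<mu> (s' 2) \<le> M \<and> t \<le> size u * (poly p (size x + N + M + 2) + 3) + 1"
    (is "_ \<Longrightarrow> _ \<Longrightarrow> _ \<Longrightarrow> _ \<Longrightarrow> _ \<Longrightarrow> \<exists>t s'. exec ?W s t s' \<and> _ \<and> _ \<and> t \<le> _ * ?K + 1")
proof (induction u arbitrary: a s)
  case Leaf
  then have "exec ?W s 1 s" by (intro exec.WhileFalse) simp
  with Leaf show ?case by (intro exI[of _ 1] exI[of _ s]) auto
next
  case (Node l r)
  let ?w = "Node l r"
  obtain t where t: "run c (Node x (Node ?w a)) t (g ?w a)" "t \<le> poly p (size x + size ?w + size a + 2)"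
    using run by blast
  have "size a \<le> M" using size[of a] Node.prems(5) by linarith
  then have t': "t \<le> poly p (size x + N + M + 2)"
    using Node.prems(4) by (intro order.trans[OF t(2) poly_mono_nat]) linarith
  have 1: "exec (Call 2 c (ENode (EVar 0) (ENode (EVar 1) (EVar 2)))) s (t + 1) (s(2 := g ?w a))"
    by (rule exec_Call_run) (use t(1) Node.prems in simp)
  let ?s = "s(2 := g ?w a, 1 := r)"
  have 2: "exec (Assign 1 (ERight (EVar 1))) (s(2 := g ?w a)) 1 ?s"
    using exec.Assign[of 1 "ERight (EVar 1)" "s(2 := g ?w a)"] Node.prems by simp
  have "\<mu> (g ?w a) + size r * Q \<le> \<mu> a + Q + size r * Q"
    using growth[OF Node.prems(4)] by simp
  also have "\<dots> \<le> \<mu> a + size ?w * Q" by (simp add: algebra_simps)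
  finally have "\<exists>t' s'. exec ?W ?s t' s' \<and> s' 2 = loopt g r (g ?w a) \<and> \<mu> (s' 2) \<le> M \<and>
      t' \<le> size r * ?K + 1"
    by (intro Node.IH(2)) (use Node.prems in auto)
  then obtain t' s' where 3: "exec ?W ?s t' s'" "s' 2 = loopt g r (g ?w a)" "\<mu> (s' 2) \<le> M"
      "t' \<le> size r * ?K + 1" by blast
  have "exec ?W s (t + 1 + 1 + t' + 1) s'"
    by (rule exec.WhileTrue[OF _ exec.Seq[OF 1 2] 3(1)]) (use Node.prems in simp)
  moreover have "t + 1 + 1 + t' + 1 \<le> size ?w * ?K + 1"
    using 3(4) t' by (simp add: algebra_simps)
  ultimately show ?case using 3(2,3) by (metis loopt.simps(2))
qed

text \<open>The increment \<open>q\<close> may depend on the parameter and the remaining tree, but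
  not on the accumulator: growth is then additive, and polynomially many rounds cannot compound to
  an exponential size. A general \<open>\<mu>\<close> admits bodies for which only a quantity
  comparable to the size is under control.\<close>

lemma ptime_loop_measure:
  assumes g: "ptime (\<lambda>y. g (left y) (left (right y)) (right (right y)))" and u: "ptime u" and a: "ptime a"
    and growth: "\<And>x w a. \<mu> (g x w a) \<le> \<mu> a + poly q (size x + size w)"
    and \<mu>: "\<And>a. size a \<le> \<mu> a" "\<And>a. \<mu> a \<le> poly r (size a)"
  shows "ptime (\<lambda>x. loopt (g x) (u x) (a x))"
proof -
  obtain cg pg where g: "\<And>x. \<exists>t. run cg x t (g (left x) (left (right x)) (right (right x))) \<and> t \<le> poly pg (size x)"
    using assms(1) unfolding ptime_def by blast
  have g': "\<exists>t. run cg (Node x (Node w a)) t (g x w a) \<and> t \<le> poly pg (size x + size w + size a + 2)" for x w a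
    using g[of "Node x (Node w a)"] by (simp add: algebra_simps)
  obtain cu pu where u: "\<And>x. \<exists>t. run cu x t (u x) \<and> t \<le> poly pu (size x)" "\<And>x. size (u x) \<le> poly pu (size x)"
    using assms(2) unfolding ptime_def by blast
  obtain ca pa where a: "\<And>x. \<exists>t. run ca x t (a x) \<and> t \<le> poly pa (size x)" "\<And>x. size (a x) \<le> poly pa (size x)"
    using assms(3) unfolding ptime_def by blast
  let ?W = "While (EVar 1) (Seq (Call 2 cg (ENode (EVar 0) (ENode (EVar 1) (EVar 2))))
                                (Assign 1 (ERight (EVar 1))))"
  let ?c = "Seq (Call 1 cu (EVar 0)) (Seq (Call 2 ca (EVar 0)) (Seq ?W (Assign 0 (EVar 2))))"
  let ?X = "[:0, 1:] :: nat poly"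
  \<comment> \<open>\<open>?M\<close> bounds all accumulators: the initial measure plus, for each of
    at most \<open>poly pu\<close> rounds, the increment allowed by \<open>q\<close>.
    \<open>?T\<close> sums the costs of the two initial calls, all rounds and the constant
    overhead.\<close>
  let ?M = "pcompose r pa + pu * pcompose q (?X + pu)"
  let ?T = "pu + pa + pu * (pcompose pg (?X + pu + ?M + [:2:]) + [:3:]) + [:4:]"
  have *: "\<exists>t. run ?c x t (loopt (g x) (u x) (a x)) \<and> t \<le> poly ?T (size x) \<and>
      size (loopt (g x) (u x) (a x)) \<le> poly ?M (size x)" for x
  proof -
    obtain t1 where t1: "run cu x t1 (u x)" "t1 \<le> poly pu (size x)" using u by blast
    obtain t2 where t2: "run ca x t2 (a x)" "t2 \<le> poly pa (size x)" using a by blast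
    let ?s = "init_store x"
    let ?s' = "?s(1 := u x, 2 := a x)"
    have 1: "exec (Call 1 cu (EVar 0)) ?s (t1 + 1) (?s(1 := u x))"
      by (rule exec_Call_run) (simp add: t1)
    have 2: "exec (Call 2 ca (EVar 0)) (?s(1 := u x)) (t2 + 1) ?s'"
      by (rule exec_Call_run) (simp add: t2)
    let ?N = "poly pu (size x)"
    let ?Q = "poly q (size x + ?N)"
    have M: "\<mu> (a x) + size (u x) * ?Q \<le> poly ?M (size x)"
      using add_mono[OF order.trans[OF \<mu>(2)[of "a x"] poly_mono_nat[OF a(2)[of x]]]
          mult_le_mono1[OF u(2)[of x], of ?Q]]
      by (simp add: poly_pcompose)
    have "\<exists>t s'. exec ?W ?s' t s' \<and> s' 2 = loopt (g x) (u x) (a x) \<and> \<mu> (s' 2) \<le> poly ?M (size x) \<and>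
        t \<le> size (u x) * (poly pg (size x + ?N + poly ?M (size x) + 2) + 3) + 1"
    proof (rule exec_loop[OF g' _ \<mu>(1) _ _ _ u(2) M])
      fix w b :: tree assume "size w \<le> ?N"
      then have "poly q (size x + size w) \<le> ?Q" by (intro poly_mono_nat) simp
      then show "\<mu> (g x w b) \<le> \<mu> b + ?Q" using growth[of x w b] by linarith
    qed auto
    then obtain t3 s' where 3: "exec ?W ?s' t3 s'" "s' 2 = loopt (g x) (u x) (a x)"
        "\<mu> (s' 2) \<le> poly ?M (size x)"
        "t3 \<le> size (u x) * (poly pg (size x + ?N + poly ?M (size x) + 2) + 3) + 1" by blast
    have "exec ?c ?s (t1 + 1 + (t2 + 1 + (t3 + 1))) (s'(0 := s' 2))"
      using exec.Seq[OF 1 exec.Seq[OF 2 exec.Seq[OF 3(1) exec.Assign[of 0 "EVar 2"]]]] by simp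
    then have "run ?c x (t1 + 1 + (t2 + 1 + (t3 + 1))) (loopt (g x) (u x) (a x))"
      unfolding run_def 3(2)[symmetric] by force
    moreover have "t3 \<le> ?N * (poly pg (size x + ?N + poly ?M (size x) + 2) + 3) + 1"
      using 3(4) mult_le_mono1[OF u(2)[of x], of "poly pg (size x + ?N + poly ?M (size x) + 2) + 3"] by linarith
    then have "t1 + 1 + (t2 + 1 + (t3 + 1)) \<le> poly ?T (size x)"
      using t1(2) t2(2) by (simp add: poly_pcompose)
    moreover have "size (loopt (g x) (u x) (a x)) \<le> poly ?M (size x)"
      using order.trans[OF \<mu>(1) 3(3)] 3(2) by simp
    ultimately show ?thesis by blast
  qed
  show ?thesis by (rule ptimeI[of ?c _ ?T ?M]) (use * in blast)+
qed

lemma ptime_loop: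
  assumes "ptime (\<lambda>y. g (left y) (left (right y)) (right (right y)))" "ptime u" "ptime a"
    and "\<And>x w a. size (g x w a) \<le> size a + poly q (size x + size w)"
  shows "ptime (\<lambda>x. loopt (g x) (u x) (a x))"
  by (rule ptime_loop_measure[where \<mu> = size and q = q and r = "[:0, 1:]"]) (use assms in auto)

section \<open>Truth values\<close>

lemma enc_bool_simps [simp]: "enc_bool P = Leaf \<longleftrightarrow> \<not> P" "size (enc_bool P) \<le> Suc 0"
  by (simp_all add: enc_bool_def)

text \<open>Every tree other than \<open>Leaf\<close> counts as true, so a positive number can serve
  as a condition; results are normalised to keep them of size at most 1.\<close>

definition conj_t :: "tree \<Rightarrow> tree \<Rightarrow> tree" where
  "conj_t s t = enc_bool (s \<noteq> Leaf \<and> t \<noteq> Leaf)"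

definition disj_t :: "tree \<Rightarrow> tree \<Rightarrow> tree" where
  "disj_t s t = enc_bool (s \<noteq> Leaf \<or> t \<noteq> Leaf)"

definition neg_t :: "tree \<Rightarrow> tree" where
  "neg_t t = enc_bool (t = Leaf)"

lemma bool_t_Leaf [simp]:
  "conj_t s t = Leaf \<longleftrightarrow> s = Leaf \<or> t = Leaf" "disj_t s t = Leaf \<longleftrightarrow> s = Leaf \<and> t = Leaf"
  "neg_t t = Leaf \<longleftrightarrow> t \<noteq> Leaf"
  by (auto simp: conj_t_def disj_t_def neg_t_def)

lemma size_disj_t: "size (disj_t s t) \<le> Suc 0"
  by (simp add: disj_t_def)

lemma ptime_conj_t: "ptime f \<Longrightarrow> ptime g \<Longrightarrow> ptime (\<lambda>x. conj_t (f x) (g x))"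
proof -
  assume "ptime f" "ptime g"
  then have "ptime (\<lambda>x. if f x = Leaf then Leaf else if g x = Leaf then Leaf else Node Leaf Leaf)"
    by (intro ptime_if ptime_Leaf ptime_Node)
  also have "(\<lambda>x. if f x = Leaf then Leaf else if g x = Leaf then Leaf else Node Leaf Leaf) =
      (\<lambda>x. conj_t (f x) (g x))"
    by (auto simp: conj_t_def enc_bool_def)
  finally show ?thesis .
qed

lemma ptime_disj_t: "ptime f \<Longrightarrow> ptime g \<Longrightarrow> ptime (\<lambda>x. disj_t (f x) (g x))"
proof -
  assume "ptime f" "ptime g"
  then have "ptime (\<lambda>x. if f x = Leaf then if g x = Leaf then Leaf else Node Leaf Leaf else Node Leaf Leaf)"
    by (intro ptime_if ptime_Leaf ptime_Node)
  also have "(\<lambda>x. if f x = Leaf then if g x = Leaf then Leaf else Node Leaf Leaf else Node Leaf Leaf) =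
      (\<lambda>x. disj_t (f x) (g x))"
    by (auto simp: disj_t_def enc_bool_def)
  finally show ?thesis .
qed

lemma ptime_neg_t: "ptime f \<Longrightarrow> ptime (\<lambda>x. neg_t (f x))"
  unfolding neg_t_def enc_bool_def by (intro ptime_if ptime_Leaf ptime_Node)

section \<open>Vectors, matrices and numbers\<close>

text \<open>On the counter \<open>un n\<close> a loop sees \<open>un n, \<dots>, un 1\<close>, and \<open>right\<close> turns these into the indices
  \<open>n - 1, \<dots>, 0\<close>.\<close>

fun un :: "nat \<Rightarrow> tree" where
  "un 0 = Leaf"
| "un (Suc n) = Node Leaf (un n)"

lemma un_eq_Leaf [simp]: "un n = Leaf \<longleftrightarrow> n = 0"
  by (cases n) auto

definition ulen_t :: "tree \<Rightarrow> tree" where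
  "ulen_t v = loopt (\<lambda>w a. Node Leaf a) v Leaf"

definition drop_t :: "tree \<Rightarrow> tree \<Rightarrow> tree" where
  "drop_t i v = loopt (\<lambda>w a. right a) i v"

definition nth_t :: "tree \<Rightarrow> tree \<Rightarrow> tree" where
  "nth_t v i = left (drop_t i v)"

text \<open>On unary numbers \<open>drop_t i j\<close> is the truncated difference
  \<open>j - i\<close>; two numbers are equal when both differences vanish.\<close>

definition eq_t :: "tree \<Rightarrow> tree \<Rightarrow> tree" where
  "eq_t i j = conj_t (neg_t (drop_t i j)) (neg_t (drop_t j i))"

text \<open>The loop visits the indices in descending order and adds entries at the front, so the
  vector comes out in ascending order.\<close>

definition tab_t :: "(tree \<Rightarrow> tree) \<Rightarrow> tree \<Rightarrow> tree" where
  "tab_t h u = loopt (\<lambda>w a. Node (h (right w)) a) u Leaf"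

definition ex_t :: "(tree \<Rightarrow> tree) \<Rightarrow> tree \<Rightarrow> tree" where
  "ex_t h u = loopt (\<lambda>w a. disj_t (h (right w)) a) u Leaf"

lemma enc_list_simps [simp]: "enc_list f [] = Leaf" "enc_list f (x # xs) = Node (f x) (enc_list f xs)"
  by (simp_all add: enc_list_def)

lemma ulen_t_enc_list [simp]: "ulen_t (enc_list f xs) = un (length xs)"
proof -
  have "loopt (\<lambda>w a. Node Leaf a) (enc_list f xs) (un m) = un (length xs + m)" for m
    by (induction xs arbitrary: m) (use un.simps(2) in \<open>auto simp del: un.simps(2) simp flip: un.simps(2)\<close>)
  from this[of 0] show ?thesis by (simp add: ulen_t_def)
qed

lemma drop_t_un: "drop_t (un i) v = (right ^^ i) v"
  unfolding drop_t_def by (induction i arbitrary: v) (auto simp: funpow_swap1)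

lemma right_power_enc_list: "(right ^^ i) (enc_list f xs) = enc_list f (drop i xs)"
proof (induction i arbitrary: xs)
  case (Suc i)
  show ?case
  proof (cases xs)
    case Nil
    with Suc[of "[]"] show ?thesis by simp
  qed (use Suc in \<open>simp add: funpow_swap1\<close>)
qed simp

lemma nth_t_enc_list [simp]: "i < length xs \<Longrightarrow> nth_t (enc_list f xs) (un i) = f (xs ! i)"
  by (simp add: nth_t_def drop_t_un right_power_enc_list flip: Cons_nth_drop_Suc)

lemma un_eq_enc_list: "un n = enc_list (\<lambda>_. Leaf) [0..<n]"
proof -
  have "un n = enc_list (\<lambda>_::nat. Leaf) xs" if "length xs = n" for xs
    using that by (induction xs arbitrary: n) auto
  then show ?thesis by simp
qed

lemma eq_t_un [simp]: "eq_t (un i) (un j) = enc_bool (i = j)"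
proof -
  have "drop_t (un i) (un j) = Leaf \<longleftrightarrow> j \<le> i" for i j
    by (simp add: drop_t_un un_eq_enc_list[of j] right_power_enc_list) (cases "j \<le> i"; simp add: upt_conv_Cons)
  then show ?thesis by (auto simp: eq_t_def conj_t_def intro: arg_cong[where f = enc_bool])
qed

lemma tab_t_un [simp]: "tab_t h (un n) = enc_list (\<lambda>i. h (un i)) [0..<n]"
proof -
  have "loopt (\<lambda>w a. Node (h (right w)) a) (un n) a = foldr (\<lambda>i t. Node (h (un i)) t) [0..<n] a" for a
    by (induction n arbitrary: a) auto
  then show ?thesis by (simp add: tab_t_def enc_list_def)
qed

lemma ex_t_un [simp]: "ex_t h (un n) = enc_bool (\<exists>i<n. h (un i) \<noteq> Leaf)"
proof -
  have "loopt (\<lambda>w a. disj_t (h (right w)) a) (un n) (enc_bool P) = enc_bool ((\<exists>i<n. h (un i) \<noteq> Leaf) \<or> P)" for P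
    by (induction n arbitrary: P) (auto simp: disj_t_def less_Suc_eq intro!: arg_cong[where f = enc_bool])
  from this[of False] show ?thesis by (simp add: ex_t_def enc_bool_def)
qed

lemma ptime_proj1: "ptime (\<lambda>y. left (right y))" and ptime_proj2: "ptime (\<lambda>y. right (right y))"
  by (intro ptime_left ptime_right ptime_id)+

lemma ptime_ulen_t: "ptime f \<Longrightarrow> ptime (\<lambda>x. ulen_t (f x))"
  unfolding ulen_t_def
  by (rule ptime_loop[where q = "[:1:]"]) (auto intro!: ptime_Node ptime_Leaf ptime_proj2)

lemma ptime_drop_t: "ptime f \<Longrightarrow> ptime g \<Longrightarrow> ptime (\<lambda>x. drop_t (f x) (g x))"
  unfolding drop_t_def
  by (rule ptime_loop[where q = 0]) (auto intro!: ptime_right ptime_id size_right)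

lemma ptime_nth_t: "ptime f \<Longrightarrow> ptime g \<Longrightarrow> ptime (\<lambda>x. nth_t (f x) (g x))"
  unfolding nth_t_def by (intro ptime_left ptime_drop_t)

lemma ptime_eq_t: "ptime f \<Longrightarrow> ptime g \<Longrightarrow> ptime (\<lambda>x. eq_t (f x) (g x))"
  unfolding eq_t_def by (intro ptime_conj_t ptime_neg_t ptime_drop_t)

text \<open>A loop body receives \<open>Node x (Node w a)\<close>, but \<open>h\<close> is to be
  evaluated at the parameter \<open>x\<close> and the index \<open>right w\<close>.\<close>

lemma ptime_index:
  assumes "ptime (\<lambda>y. h (left y) (right y))"
  shows "ptime (\<lambda>y. h (left y) (right (left (right y))))"
  using ptime_comp[OF assms, of "\<lambda>y. Node (left y) (right (left (right y)))"]
  by (simp add: ptime_Node ptime_left ptime_right ptime_id)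

text \<open>Since \<open>ptime\<close> speaks of unary functions, a function of a parameter and an
  index is presented through a pair. Iterating this puts nested binders into nested pairs.\<close>

lemma ptime_tab_t:
  assumes "ptime (\<lambda>y. h (left y) (right y))" "ptime u"
  shows "ptime (\<lambda>x. tab_t (h x) (u x))"
proof -
  obtain p where p: "\<And>x. size (h (left x) (right x)) \<le> poly p (size x)"
    using assms(1) unfolding ptime_def by blast
  show ?thesis
    unfolding tab_t_def
  \<comment> \<open>A round adds one cell and an entry computed from a pair of size at most
    \<open>size x + size w + 1\<close>.\<close>
  proof (rule ptime_loop[where q = "pcompose p [:1, 1:] + [:1:]"])
    show "ptime (\<lambda>y. Node (h (left y) (right (left (right y)))) (right (right y)))"
      by (intro ptime_Node ptime_index ptime_proj2 assms)
    fix x w a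
    have "size (h x (right w)) \<le> poly p (size x + size (right w) + 1)"
      using p[of "Node x (right w)"] by simp
    also have "\<dots> \<le> poly p (size x + size w + 1)"
      by (intro poly_mono_nat) (simp add: size_right)
    finally show "size (Node (h x (right w)) a) \<le> size a + poly (pcompose p [:1, 1:] + [:1:]) (size x + size w)"
      by (simp add: poly_pcompose algebra_simps)
  qed (rule assms ptime_Leaf)+
qed

lemma ptime_ex_t:
  assumes "ptime (\<lambda>y. h (left y) (right y))" "ptime u"
  shows "ptime (\<lambda>x. ex_t (h x) (u x))"
  unfolding ex_t_def
  by (rule ptime_loop[where q = "[:1:]"])
     (auto intro!: ptime_disj_t ptime_index ptime_proj2 assms ptime_Leaf intro: order.trans[OF size_disj_t])

section \<open>Predecessor and counting in binary\<close>

fun decr :: "tree \<Rightarrow> tree" where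
  "decr Leaf = Leaf"
| "decr (Node b r) = (if b = Leaf then Node (Node Leaf Leaf) (decr r)
     else if r = Leaf then Leaf else Node Leaf r)"

definition tails_t :: "tree \<Rightarrow> tree" where
  "tails_t v = loopt Node v Leaf"

text \<open>\<open>decr\<close> recurses on the tail, but \<open>loopt\<close> works from the front with an accumulator; looping over
  the reversed list of all tails bridges the gap.\<close>

definition decr_loop :: "tree \<Rightarrow> tree" where
  "decr_loop v = loopt (\<lambda>w a. if left (left w) = Leaf then Node (Node Leaf Leaf) a
     else if right (left w) = Leaf then Leaf else Node Leaf (right (left w))) (tails_t v) Leaf"

lemma decr_eq_decr_loop: "decr v = decr_loop v"
proof -
  let ?g = "\<lambda>w a. if left (left w) = Leaf then Node (Node Leaf Leaf) a
     else if right (left w) = Leaf then Leaf else Node Leaf (right (left w))"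
  \<comment> \<open>Generalised over the stack \<open>acc\<close> below the tails of
    \<open>v\<close>: the shortest tail lies on top, so by the time \<open>acc\<close> is reached
    the accumulator has grown from the last bit to all of \<open>v\<close>.\<close>
  have "loopt ?g (loopt Node v acc) Leaf = loopt ?g acc (decr v)" for acc
    by (induction v arbitrary: acc) auto
  from this[of Leaf] show ?thesis by (simp add: decr_loop_def tails_t_def)
qed

lemma ptime_decr: "ptime f \<Longrightarrow> ptime (\<lambda>x. decr (f x))"
proof (rule ptime_comp[of decr])
  have t: "ptime tails_t"
    unfolding tails_t_def
    by (rule ptime_loop[where g = "\<lambda>x. Node" and q = "[:1, 1:]"])
       (auto intro!: ptime_Node ptime_proj1 ptime_proj2 ptime_id ptime_Leaf)
  have "ptime decr_loop"
    unfolding decr_loop_def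
  proof (rule ptime_loop[where q = "[:2, 1:]"])
    fix x w a :: tree
    have "size (right (left w)) \<le> size w" using size_right[of "left w"] size_left[of w] by linarith
    then show "size (if left (left w) = Leaf then Node (Node Leaf Leaf) a
         else if right (left w) = Leaf then Leaf else Node Leaf (right (left w)))
        \<le> size a + poly [:2, 1:] (size x + size w)" by auto
  qed (intro ptime_if ptime_Node ptime_left ptime_right ptime_id ptime_Leaf t)+
  moreover have "decr = decr_loop" by (rule ext) (rule decr_eq_decr_loop)
  ultimately show "ptime decr" by simp
qed

lemma enc_nat_0 [simp]: "enc_nat 0 = Leaf"
  by (simp add: enc_nat.simps)

lemma enc_nat_eq_Leaf [simp]: "enc_nat m = Leaf \<longleftrightarrow> m = 0"
  by (subst enc_nat.simps) simp

text \<open>The test \<open>r = Leaf\<close> in \<open>decr\<close> removes a leading zero, which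
  keeps the numeral canonical; a zero bit borrows from the rest by the recursive call. Zero stays
  zero, matching truncated subtraction.\<close>

lemma decr_enc_nat [simp]: "decr (enc_nat m) = enc_nat (m - 1)"
proof (induction m rule: less_induct)
  case (less m)
  consider "m = 0" | "m = 1" | "odd m" "m > 1" | "even m" "m > 0"
    by (metis One_nat_def bot_nat_0.not_eq_extremum even_zero less_one linorder_neqE_nat)
  then show ?case
  proof cases
    case 3
    then have "(m - 1) div 2 = m div 2" "m div 2 \<noteq> 0" by presburger+
    with 3 show ?thesis
      by (subst (1 2) enc_nat.simps) (simp add: enc_bool_def)
  next
    case 4
    then have "m div 2 < m" "odd (m - 1)" "(m - 1) div 2 = m div 2 - 1" "m - 1 \<noteq> 0" by presburger+
    with 4 less show ?thesis
      by (subst (1 2) enc_nat.simps) (simp add: enc_bool_def)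
  qed (simp_all add: enc_nat.simps enc_bool_def)
qed

text \<open>Decrementing once per index that satisfies \<open>h\<close> gives the reduced budget and
  also compares cardinalities: the result is positive iff fewer than \<open>m\<close> indices
  satisfy \<open>h\<close>. Loops run over vertices, never over \<open>k\<close> or
  \<open>\<alpha>\<close>, whose values can be exponential in the size of their binary
  encodings.\<close>

definition count_down_t :: "(tree \<Rightarrow> tree) \<Rightarrow> tree \<Rightarrow> tree \<Rightarrow> tree" where
  "count_down_t h u m = loopt (\<lambda>w a. if h (right w) = Leaf then a else decr a) u m"

lemma count_down_t_un [simp]:
  "count_down_t h (un n) (enc_nat m) = enc_nat (m - card {i. i < n \<and> h (un i) \<noteq> Leaf})"
  unfolding count_down_t_def
proof (induction n arbitrary: m)
  case (Suc n)
  have "{i. i < Suc n \<and> h (un i) \<noteq> Leaf} =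
      (if h (un n) = Leaf then {} else {n}) \<union> {i. i < n \<and> h (un i) \<noteq> Leaf}"
    by (auto simp: less_Suc_eq)
  with Suc show ?case by simp
qed simp

text \<open>Decrementing can turn zero bits into one bits and so increase \<open>size\<close>; this measure charges
  both bits equally.\<close>

fun bits_size :: "tree \<Rightarrow> nat" where
  "bits_size Leaf = 0"
| "bits_size (Node b r) = 1 + max 1 (size b) + bits_size r"

lemma bits_size_decr: "bits_size (decr v) \<le> bits_size v"
  by (induction v rule: decr.induct) auto

lemma ptime_count_down_t:
  assumes "ptime (\<lambda>y. h (left y) (right y))" "ptime u" "ptime m"
  shows "ptime (\<lambda>x. count_down_t (h x) (u x) (m x))"
  unfolding count_down_t_def
proof (rule ptime_loop_measure[where \<mu> = bits_size and q = 0 and r = "[:0, 2:]"])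
  show "ptime (\<lambda>y. if h (left y) (right (left (right y))) = Leaf then right (right y) else decr (right (right y)))"
    by (intro ptime_if ptime_index ptime_proj2 ptime_decr assms)
  show "size a \<le> bits_size a" for a by (induction a) auto
  show "bits_size a \<le> poly [:0, 2:] (size a)" for a by (induction a) auto
qed (auto intro: assms bits_size_decr)

lemmas ptime_intros = ptime_id ptime_Leaf ptime_left ptime_right ptime_Node ptime_conj_t ptime_disj_t
  ptime_neg_t ptime_nth_t ptime_eq_t ptime_tab_t ptime_ex_t ptime_count_down_t ptime_ulen_t

section \<open>Graph distance\<close>

lemma relpow_in_V:
  assumes "E \<subseteq> V \<times> V" "(u, v) \<in> E ^^ m" "u \<in> V" shows "v \<in> V"
  using assms by (cases m) auto

lemma connected_graph_finite: "connected_graph V E \<Longrightarrow> finite V"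
  by (simp add: connected_graph_def simple_graph_def)

text \<open>Connectivity ensures that the minimum in \<open>gdist\<close> is attained. The length is
  only bounded by \<open>m\<close>, since a walk cannot in general be padded to length exactly
  \<open>m\<close>.\<close>

lemma gdist_le_iff:
  assumes "connected_graph V E" "u \<in> V" "v \<in> V"
  shows "gdist E u v \<le> m \<longleftrightarrow> (\<exists>l\<le>m. (u, v) \<in> E ^^ l)"
proof
  obtain l where "(u, v) \<in> E ^^ l"
    using assms rtrancl_imp_relpow unfolding connected_graph_def by blast
  then have "(u, v) \<in> E ^^ gdist E u v" unfolding gdist_def by (rule LeastI)
  then show "gdist E u v \<le> m \<Longrightarrow> \<exists>l\<le>m. (u, v) \<in> E ^^ l" by blast
qed (auto simp: gdist_def intro: order.trans[OF Least_le])

text \<open>Cutting a walk after \<open>a\<close> steps, or at its end if it is shorter, gives the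
  intermediate vertex. This direction makes Boolean products of distance matrices correct; the other
  is the triangle inequality.\<close>

lemma gdist_add_le_iff:
  assumes G: "connected_graph V E" and "u \<in> V" "v \<in> V"
  shows "gdist E u v \<le> a + b \<longleftrightarrow> (\<exists>w\<in>V. gdist E u w \<le> a \<and> gdist E w v \<le> b)"
proof
  assume "gdist E u v \<le> a + b"
  then obtain l where l: "l \<le> a + b" "(u, v) \<in> E ^^ l" using gdist_le_iff[OF assms] by blast
  have "l = min a l + (l - min a l)" by simp
  then obtain w where w: "(u, w) \<in> E ^^ min a l" "(w, v) \<in> E ^^ (l - min a l)"
    using l(2) relpow_add[of "min a l" "l - min a l" E] by (metis relcompE prod.inject)
  then have "w \<in> V" using relpow_in_V[of E V u w] G assms unfolding connected_graph_def simple_graph_def by blast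
  moreover have "min a l \<le> a" "l - min a l \<le> b" using l by auto
  ultimately show "\<exists>w\<in>V. gdist E u w \<le> a \<and> gdist E w v \<le> b"
    using w assms gdist_le_iff[OF G] by blast
next
  assume "\<exists>w\<in>V. gdist E u w \<le> a \<and> gdist E w v \<le> b"
  then obtain w i j where "w \<in> V" "i \<le> a" "(u, w) \<in> E ^^ i" "j \<le> b" "(w, v) \<in> E ^^ j"
    using gdist_le_iff[OF G] assms by meson
  then have "(u, v) \<in> E ^^ (i + j)" "i + j \<le> a + b" by (auto simp: relpow_add)
  then show "gdist E u v \<le> a + b" using gdist_le_iff[OF assms] by blast
qed

lemma gdist_triangle:
  assumes "connected_graph V E" "u \<in> V" "w \<in> V" "v \<in> V"
  shows "gdist E u v \<le> gdist E u w + gdist E w v"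
  using gdist_add_le_iff[OF assms(1,2,4)] assms(3) by blast

lemma gdist_self [simp]: "gdist E u u = 0"
  unfolding gdist_def by (intro Least_equality) auto

lemma gdist_le_1_iff:
  assumes "connected_graph V E" "u \<in> V" "v \<in> V"
  shows "gdist E u v \<le> 1 \<longleftrightarrow> u = v \<or> (u, v) \<in> E"
  unfolding gdist_le_iff[OF assms] by (auto simp: le_Suc_eq)

lemma gdist_commute:
  assumes "connected_graph V E"
  shows "gdist E u v = gdist E v u"
proof -
  have "sym E" using assms by (simp add: connected_graph_def simple_graph_def)
  have "(u, v) \<in> E ^^ m \<Longrightarrow> (v, u) \<in> E ^^ m" for u v m
  proof (induction m arbitrary: v)
    case (Suc m)
    then obtain w where "(u, w) \<in> E ^^ m" "(w, v) \<in> E" by auto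
    then show ?case using Suc.IH[of w] \<open>sym E\<close> by (metis symD relpow_Suc_I2)
  qed auto
  then have "(u, v) \<in> E ^^ m \<longleftrightarrow> (v, u) \<in> E ^^ m" for m by blast
  then show ?thesis by (simp add: gdist_def)
qed

text \<open>A vertex can be added to an independent set exactly if it is farther than
  \<open>r\<close> from all its members, so maximality amounts to covering with radius
  \<open>r\<close>. The greedy program yields the cover; the analysis needs the converse
  below.\<close>

lemma maximal_dist_independentI:
  assumes "connected_graph V E" "A \<subseteq> V" "dist_independent E (Suc r) A"
    and "\<And>u. u \<in> V \<Longrightarrow> \<exists>a\<in>A. gdist E u a \<le> r"
  shows "maximal_dist_independent V E (Suc r) A"
  unfolding maximal_dist_independent_def
proof (intro conjI allI impI notI)
  fix A' assume A': "A \<subset> A' \<and> A' \<subseteq> V" "dist_independent E (Suc r) A'"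
  then obtain u where u: "u \<in> A'" "u \<notin> A" "u \<in> V" by blast
  then obtain a where "a \<in> A" "gdist E u a \<le> r" using assms(4) by blast
  with A' u show False unfolding dist_independent_def by (metis not_less_eq_eq psubsetD)
qed (rule assms)+

lemma maximal_dist_independent_cover:
  assumes "connected_graph V E" "maximal_dist_independent V E (Suc r) A" "u \<in> V"
  shows "\<exists>a\<in>A. gdist E u a \<le> r"
proof (rule ccontr)
  assume *: "\<not> ?thesis"
  then have "u \<notin> A" by auto
  then have "\<not> dist_independent E (Suc r) (insert u A)"
    using assms unfolding maximal_dist_independent_def by blast
  then show False
    using assms(2) * gdist_commute[OF assms(1)]
    unfolding maximal_dist_independent_def dist_independent_def by (metis insert_iff not_less_eq_eq)
qed

section \<open>Approximation guarantee\<close>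

text \<open>Otherwise all these centers could fail together, and then the client \<open>a\<close>
  itself would have no center of \<open>VL\<close> within distance 1.\<close>

lemma ft_solution_many_neighbours:
  assumes V: "finite V" and sol: "ft_solution V E L k VL \<alpha> 1 S \<phi>0" and a: "a \<in> V"
  shows "\<alpha> < card (nbhd V E a \<inter> VL \<inter> S)"
proof (rule ccontr)
  let ?F = "nbhd V E a \<inter> VL \<inter> S"
  assume "\<not> ?thesis"
  then obtain \<phi> where \<phi>: "cap_assignment V E L VL 1 (S - ?F) \<phi>"
    using sol unfolding ft_solution_def by (metis Int_lower2 not_less)
  have 1: "\<phi> a \<in> S - ?F" "gdist E a (\<phi> a) \<le> 1" using \<phi> a unfolding cap_assignment_def by fastforce+
  \<comment> \<open>A center of capacity 0 has no clients, but \<open>\<phi> a\<close> has the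
    client \<open>a\<close>.\<close>
  have "\<phi> a \<in> VL"
  proof (rule ccontr)
    assume "\<phi> a \<notin> VL"
    then have "card {u \<in> V. \<phi> u = \<phi> a} = 0" using \<phi> 1 unfolding cap_assignment_def by blast
    then show False using a V by auto
  qed
  then show False using 1 sol unfolding ft_solution_def nbhd_def by blast
qed

text \<open>Passing through \<open>x\<close> and \<open>y\<close> would give a distance of at most 1
  + 4 + 1 < 7. The allowance 4 is what two failed centers can be apart when clients of both move to
  the same center.\<close>

lemma nbhd_unique:
  assumes G: "connected_graph V E" and A: "dist_independent E 7 A" "A \<subseteq> V"
    and "a \<in> A" "b \<in> A" "x \<in> nbhd V E a" "y \<in> nbhd V E b" "gdist E x y \<le> 4"
  shows "a = b"
proof (rule ccontr)
  assume "a \<noteq> b"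
  then have "7 \<le> gdist E a b" using A assms(4,5) unfolding dist_independent_def by blast
  moreover have V: "a \<in> V" "b \<in> V" "x \<in> V" "y \<in> V" using assms unfolding nbhd_def by auto
  moreover have "gdist E a x \<le> 1" "gdist E b y \<le> 1" using assms unfolding nbhd_def by auto
  ultimately show False
    using gdist_triangle[OF G V(1,3,2)] gdist_triangle[OF G V(3,4,2)] gdist_commute[OF G, of y b] assms(8)
    by linarith
qed

section \<open>From a fault-tolerant to a capacitated solution: failure is justified\<close>

lemma cap_solution_of_ft_solution:
  assumes G: "connected_graph V E"
    and sol: "ft_solution V E L k VL \<alpha> 1 S \<phi>0"
    and A: "A \<subseteq> V" "dist_independent E 7 A"
    and Bf: "\<And>a. a \<in> A \<Longrightarrow> Bf a \<subseteq> nbhd V E a \<inter> VL" "\<And>a. a \<in> A \<Longrightarrow> card (Bf a) = \<alpha>"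
    and B: "B = (\<Union>a\<in>A. Bf a)"
  shows "\<exists>S \<phi>. cap_solution V E L (k - card B) (VL - B) 1 S \<phi>"
proof -
  have fin: "finite V" using G by (rule connected_graph_finite)
  have S: "S \<subseteq> V" "card S \<le> k" "cap_assignment V E L VL 1 S \<phi>0"
    using sol by (auto simp: ft_solution_def)
  \<comment> \<open>\<open>Bf a\<close> need not lie in \<open>S\<close>. Its part in
    \<open>S\<close> is filled up to exactly \<open>\<alpha>\<close> centers, so that at least
    \<open>card B\<close> centers are removed in total.\<close>
  have "\<exists>F. Bf a \<inter> S \<subseteq> F \<and> F \<subseteq> nbhd V E a \<inter> VL \<inter> S \<and> card F = \<alpha>" if "a \<in> A" for a
  proof (rule exists_subset_between)
    show finN: "finite (nbhd V E a \<inter> VL \<inter> S)" using fin by (simp add: nbhd_def)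
    show "Bf a \<inter> S \<subseteq> nbhd V E a \<inter> VL \<inter> S" using Bf that by blast
    have "finite (Bf a)" using Bf(1)[OF that] fin by (rule_tac finite_subset[of _ V]) (auto simp: nbhd_def)
    then show "card (Bf a \<inter> S) \<le> \<alpha>" using Bf(2)[OF that] by (metis card_mono Int_lower1)
    show "\<alpha> \<le> card (nbhd V E a \<inter> VL \<inter> S)"
      using ft_solution_many_neighbours[OF fin sol] that A by fastforce
  qed
  then obtain Ff where Ff: "\<And>a. a \<in> A \<Longrightarrow> Bf a \<inter> S \<subseteq> Ff a"
    "\<And>a. a \<in> A \<Longrightarrow> Ff a \<subseteq> nbhd V E a \<inter> VL \<inter> S" "\<And>a. a \<in> A \<Longrightarrow> card (Ff a) = \<alpha>" by metis
  \<comment> \<open>Fault tolerance is applied to each \<open>Ff a\<close> separately, because their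
    union may have more than \<open>\<alpha>\<close> elements.\<close>
  have "\<exists>\<phi>. cap_assignment V E L VL 1 (S - Ff a) \<phi> \<and> (\<forall>u\<in>V. \<phi>0 u \<notin> Ff a \<longrightarrow> \<phi> u = \<phi>0 u)" if "a \<in> A" for a
  proof -
    have "Ff a \<subseteq> S" "card (Ff a) \<le> \<alpha>" using Ff(2,3)[OF that] by auto
    then show ?thesis using sol unfolding ft_solution_def by blast
  qed
  then obtain \<psi> where \<psi>: "\<And>a. a \<in> A \<Longrightarrow> cap_assignment V E L VL 1 (S - Ff a) (\<psi> a)"
    "\<And>a u. a \<in> A \<Longrightarrow> u \<in> V \<Longrightarrow> \<phi>0 u \<notin> Ff a \<Longrightarrow> \<psi> a u = \<phi>0 u" by metis
  have uniq: "a = b" if "a \<in> A" "b \<in> A" "x \<in> Ff a" "y \<in> Ff b" "gdist E x y \<le> 4" for a b x y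
    using nbhd_unique[OF G A(2,1) that(1,2) _ _ that(5)] Ff(2) that by blast
  define F where "F = (\<Union>a\<in>A. Ff a)"
  \<comment> \<open>A client of a failed center follows the repair of the unique \<open>a\<close>
    whose failed set contains that center; all others stay.\<close>
  define \<phi> where "\<phi> u = (if \<phi>0 u \<in> F then \<psi> (THE a. a \<in> A \<and> \<phi>0 u \<in> Ff a) u else \<phi>0 u)" for u
  have \<phi>_in: "\<phi> u = \<psi> a u" if "a \<in> A" "\<phi>0 u \<in> Ff a" for a u
  proof -
    have "(THE a. a \<in> A \<and> \<phi>0 u \<in> Ff a) = a"
    proof (rule the_equality)
      show "b = a" if "b \<in> A \<and> \<phi>0 u \<in> Ff b" for b
        by (rule uniq[of b a "\<phi>0 u" "\<phi>0 u"]) (use that \<open>a \<in> A\<close> \<open>\<phi>0 u \<in> Ff a\<close> in auto)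
    qed (use that in blast)
    then show ?thesis using that by (auto simp: \<phi>_def F_def)
  qed
  have \<phi>_out: "\<phi> u = \<phi>0 u" if "\<phi>0 u \<notin> F" for u using that by (simp add: \<phi>_def)
  have d0: "\<phi>0 u \<in> S" "gdist E u (\<phi>0 u) \<le> 1" if "u \<in> V" for u
    using S(3) that unfolding cap_assignment_def by fastforce+
  have d1: "\<psi> a u \<in> S - Ff a" "gdist E u (\<psi> a u) \<le> 1" if "u \<in> V" "a \<in> A" for a u
    using \<psi>(1)[OF that(2)] that(1) unfolding cap_assignment_def by fastforce+
  have \<phi>: "\<phi> u \<in> S - F \<and> gdist E u (\<phi> u) \<le> 1" if u: "u \<in> V" for u
  proof (cases "\<phi>0 u \<in> F")
    case True
    then obtain a where a: "a \<in> A" "\<phi>0 u \<in> Ff a" by (auto simp: F_def)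
    \<comment> \<open>The repair for \<open>a\<close> avoids \<open>Ff a\<close> by construction. It
      also avoids every other \<open>Ff b\<close>, as the old and new centers of \<open>u\<close>
      are at most 1 + 1 apart.\<close>
    have "\<psi> a u \<notin> Ff b" if b: "b \<in> A" for b
    proof
      assume *: "\<psi> a u \<in> Ff b"
      have "gdist E (\<phi>0 u) (\<psi> a u) \<le> 2"
        using gdist_triangle[OF G, of "\<phi>0 u" u "\<psi> a u"] d0[OF u] d1[OF u a(1)] S(1) u
          gdist_commute[OF G, of u "\<phi>0 u"] by fastforce
      then have "a = b" using uniq[OF a(1) b a(2) *] by simp
      with * d1[OF u a(1)] show False by blast
    qed
    then show ?thesis using d1[OF u a(1)] \<phi>_in[OF a] by (auto simp: F_def)
  qed (use d0[OF u] \<phi>_out in auto)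
  \<comment> \<open>All clients of \<open>v\<close> are also its clients under one known assignment,
    which passes on both capacity conditions. If some client has moved to \<open>v\<close>, this is
    the repair of a single \<open>a\<close>: old centers of two moved clients are within 2 + 2 of
    each other through \<open>v\<close>, and clients that have not moved are kept by that
    repair.\<close>
  have load: "\<exists>\<chi> S'. cap_assignment V E L VL 1 S' \<chi> \<and> v \<in> S' \<and> {u \<in> V. \<phi> u = v} \<subseteq> {u \<in> V. \<chi> u = v}"
    if v: "v \<in> S - F" for v
  proof (cases "\<exists>u\<in>V. \<phi>0 u \<in> F \<and> \<phi> u = v")
    case True
    then obtain u a where u: "u \<in> V" "\<phi> u = v" and a: "a \<in> A" "\<phi>0 u \<in> Ff a" by (auto simp: F_def)
    have "\<psi> a u' = v" if u': "u' \<in> V" "\<phi> u' = v" for u'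
    proof (cases "\<phi>0 u' \<in> F")
      case True
      then obtain b where b: "b \<in> A" "\<phi>0 u' \<in> Ff b" by (auto simp: F_def)
      have inV: "\<phi>0 u \<in> V" "\<phi>0 u' \<in> V" "v \<in> V" using d0 u u' S(1) v by auto
      have "gdist E (\<phi>0 u) v \<le> 2"
        using gdist_triangle[OF G inV(1) u(1) inV(3)] d0[OF u(1)] \<phi>[OF u(1)] u(2) gdist_commute[OF G, of u "\<phi>0 u"]
        by simp
      moreover have "gdist E v (\<phi>0 u') \<le> 2"
        using gdist_triangle[OF G inV(3) u'(1) inV(2)] d0[OF u'(1)] \<phi>[OF u'(1)] u'(2) gdist_commute[OF G, of u' v]
        by simp
      ultimately have "gdist E (\<phi>0 u) (\<phi>0 u') \<le> 4"
        using gdist_triangle[OF G inV(1) inV(3) inV(2)] by simp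
      then have "a = b" using uniq[OF a(1) b(1) a(2) b(2)] by simp
      then show ?thesis using \<phi>_in[OF b] u' by simp
    next
      case False
      then show ?thesis using \<psi>(2)[OF a(1) u'(1)] \<phi>_out u' a(1) by (auto simp: F_def)
    qed
    then have "{u \<in> V. \<phi> u = v} \<subseteq> {u \<in> V. \<psi> a u = v}" by blast
    moreover have "v \<in> S - Ff a" using v a by (auto simp: F_def)
    ultimately show ?thesis using \<psi>(1)[OF a(1)] by blast
  next
    case False
    then have "{u \<in> V. \<phi> u = v} \<subseteq> {u \<in> V. \<phi>0 u = v}" using \<phi>_out by auto
    then show ?thesis using S(3) v by blast
  qed
  have finA: "finite A" using A fin finite_subset by blast
  have finFf: "finite (Ff a)" if "a \<in> A" for a
    using Ff(2)[OF that] fin by (rule_tac finite_subset[of _ V]) (auto simp: nbhd_def)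
  \<comment> \<open>Disjointness makes this an equality, with value \<open>\<alpha>\<close> times
    \<open>card A\<close>; for \<open>B\<close> the union bound points in the right
    direction.\<close>
  have "card F = (\<Sum>a\<in>A. card (Ff a))"
    unfolding F_def
  proof (rule card_UN_disjoint)
    have "Ff a \<inter> Ff b = {}" if ab: "a \<in> A" "b \<in> A" "a \<noteq> b" for a b
    proof (rule ccontr)
      assume "Ff a \<inter> Ff b \<noteq> {}"
      then obtain x where "x \<in> Ff a" "x \<in> Ff b" by blast
      then show False using uniq[OF ab(1,2), of x x] ab(3) by simp
    qed
    then show "\<forall>a\<in>A. \<forall>b\<in>A. a \<noteq> b \<longrightarrow> Ff a \<inter> Ff b = {}" by blast
  qed (use finA finFf in blast)+
  moreover have "card B \<le> (\<Sum>a\<in>A. card (Bf a))" unfolding B by (rule card_UN_le[OF finA])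
  ultimately have "card B \<le> card F" using Ff(3) Bf(2) by simp
  moreover have "F \<subseteq> S" "finite F" using Ff(2) finA finFf by (auto simp: F_def)
  ultimately have "card (S - F) \<le> k - card B" using S(2) by (simp add: card_Diff_subset)
  moreover have "cap_assignment V E L (VL - B) 1 (S - F) \<phi>"
    unfolding cap_assignment_def
  proof (intro conjI ballI)
    fix v assume v: "v \<in> (S - F) \<inter> (VL - B)"
    then obtain \<chi> S' where \<chi>: "cap_assignment V E L VL 1 S' \<chi>" "v \<in> S'" "{u \<in> V. \<phi> u = v} \<subseteq> {u \<in> V. \<chi> u = v}"
      using load by blast
    then have "card {u \<in> V. \<phi> u = v} \<le> card {u \<in> V. \<chi> u = v}" using fin by (intro card_mono) auto
    also have "\<dots> \<le> L" using \<chi> v unfolding cap_assignment_def by blast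
    finally show "card {u \<in> V. \<phi> u = v} \<le> L" .
  next
    fix v assume v: "v \<in> (S - F) - (VL - B)"
    then obtain \<chi> S' where \<chi>: "cap_assignment V E L VL 1 S' \<chi>" "v \<in> S'" "{u \<in> V. \<phi> u = v} \<subseteq> {u \<in> V. \<chi> u = v}"
      using load by blast
    \<comment> \<open>Elements of \<open>B\<close> in \<open>S\<close> have all been put into
      \<open>F\<close>, so on \<open>S - F\<close> the capacities for \<open>VL\<close> and
      \<open>VL - B\<close> coincide.\<close>
    have "v \<notin> B" using v Ff(1) by (auto simp: B F_def)
    then have "card {u \<in> V. \<chi> u = v} = 0" using \<chi> v unfolding cap_assignment_def by blast
    then show "card {u \<in> V. \<phi> u = v} = 0" using \<chi>(3) fin by auto
  qed (use \<phi> in auto)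
  ultimately show ?thesis using S(1) unfolding cap_solution_def by blast
qed

section \<open>From a capacitated to a fault-tolerant solution: backups absorb failures\<close>

lemma ft_solution_of_cap_solution:
  assumes G: "connected_graph V E" and VL: "VL \<subseteq> V"
    and A: "maximal_dist_independent V E 7 A"
    and Bf: "\<And>a. a \<in> A \<Longrightarrow> Bf a \<subseteq> nbhd V E a \<inter> VL" "\<And>a. a \<in> A \<Longrightarrow> card (Bf a) = \<alpha>"
    and B: "B = (\<Union>a\<in>A. Bf a)"
    and sol: "cap_solution V E L (k - card B) (VL - B) \<beta> S \<phi>"
  shows "ft_solution V E L k VL \<alpha> (max 7 \<beta>) (S \<union> B) \<phi>"
proof -
  have fin: "finite V" and ne: "V \<noteq> {}" using G by (auto simp: connected_graph_def simple_graph_def)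
  have A': "A \<subseteq> V" "dist_independent E 7 A" using A by (auto simp: maximal_dist_independent_def)
  have S: "S \<subseteq> V" "card S \<le> k - card B" "cap_assignment V E L (VL - B) \<beta> S \<phi>"
    using sol by (auto simp: cap_solution_def)
  have \<phi>: "\<phi> u \<in> S" "gdist E u (\<phi> u) \<le> \<beta>" if "u \<in> V" for u
    using S(3) that unfolding cap_assignment_def by blast+
  \<comment> \<open>A nonempty \<open>S\<close> forces \<open>k - card B > 0\<close>, so the
    truncated subtraction is a genuine one and \<open>S \<union> B\<close> fits the budget.\<close>
  have "S \<noteq> {}" using \<phi>(1) ne by blast
  then have "0 < card S" using S(1) fin by (meson card_gt_0_iff finite_subset)
  then have "card B \<le> k" "card S + card B \<le> k" using S(2) by linarith+
  then have cardSB: "card (S \<union> B) \<le> k" using card_Un_le[of S B] by linarith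
  have BVL: "B \<subseteq> VL" using Bf(1) B by blast
  \<comment> \<open>Removing \<open>B\<close> from the capacitated vertices means that no client is
    assigned to a backup, so each backup starts idle even if it lies in \<open>S\<close>.\<close>
  have \<phi>B: "\<phi> u \<in> VL - B" if u: "u \<in> V" for u
  proof (rule ccontr)
    assume "\<phi> u \<notin> VL - B"
    then have "card {w \<in> V. \<phi> w = \<phi> u} = 0" using S(3) \<phi>(1)[OF u] unfolding cap_assignment_def by blast
    then show False using u fin by auto
  qed
  obtain c where c: "\<And>u. u \<in> V \<Longrightarrow> c u \<in> A" "\<And>u. u \<in> V \<Longrightarrow> gdist E u (c u) \<le> 6"
  proof -
    have "\<forall>u\<in>V. \<exists>a\<in>A. gdist E u a \<le> 6"
      using maximal_dist_independent_cover[OF G, of 6 A] A by simp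
    then show ?thesis using that by metis
  qed
  have uniq: "a = b" if "a \<in> A" "b \<in> A" "x \<in> Bf a" "x \<in> Bf b" for a b x
    using nbhd_unique[OF G A'(2,1) that(1,2), of x x] Bf(1) that by auto
  \<comment> \<open>This form gives agreement with \<open>\<phi>\<close> outside \<open>F\<close>
    directly, and for \<open>F = {}\<close> the validity of \<open>\<phi>\<close> itself.\<close>
  have main: "\<exists>g. cap_assignment V E L VL (max 7 \<beta>) (S \<union> B - F) (\<lambda>u. if \<phi> u \<in> F then g u else \<phi> u)"
    if F: "F \<subseteq> S \<union> B" "card F \<le> \<alpha>" for F
  proof -
    have finF: "finite F" using F(1) S(1) BVL VL fin by (meson Un_least finite_subset order.trans)
    have "\<exists>g. g ` (F - B) \<subseteq> Bf a - F \<and> inj_on g (F - B)" if a: "a \<in> A" for a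
    proof (rule card_le_inj)
      have finB: "finite (Bf a)" using Bf(1)[OF a] fin by (rule_tac finite_subset[of _ V]) (auto simp: nbhd_def)
      then show "finite (Bf a - F)" "finite (F - B)" using finF by auto
      \<comment> \<open>Each failure inside \<open>Bf a\<close> costs one backup but also uses up
        one of the at most \<open>\<alpha>\<close> failures, so enough backups survive for the
        failures outside \<open>B\<close>.\<close>
      have "card (F - B) = card F - card (F \<inter> B)" using finF by (simp add: card_Diff_subset_Int)
      also have "\<dots> \<le> \<alpha> - card (Bf a \<inter> F)"
      proof -
        have "card (Bf a \<inter> F) \<le> card (F \<inter> B)" using finF a by (intro card_mono) (auto simp: B)
        then show ?thesis using F(2) by linarith
      qed
      also have "\<dots> = card (Bf a - F)" using Bf(2)[OF a] finB by (simp add: card_Diff_subset_Int)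
      finally show "card (F - B) \<le> card (Bf a - F)" .
    qed
    then obtain g where g: "\<And>a. a \<in> A \<Longrightarrow> g a ` (F - B) \<subseteq> Bf a - F" "\<And>a. a \<in> A \<Longrightarrow> inj_on (g a) (F - B)"
      by metis
    define \<psi> where "\<psi> u = (if \<phi> u \<in> F then g (c u) (\<phi> u) else \<phi> u)" for u
    have gu: "g (c u) (\<phi> u) \<in> Bf (c u) - F" if "u \<in> V" "\<phi> u \<in> F" for u
      using g(1)[OF c(1)[OF that(1)]] that \<phi>B[OF that(1)] by blast
    have "cap_assignment V E L VL (max 7 \<beta>) (S \<union> B - F) \<psi>"
      unfolding cap_assignment_def
    proof (intro conjI ballI)
      fix u assume u: "u \<in> V"
      show "\<psi> u \<in> S \<union> B - F" using gu[OF u] \<phi>(1)[OF u] c(1)[OF u] by (auto simp: \<psi>_def B)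
      show "real (gdist E u (\<psi> u)) \<le> max 7 \<beta>"
      proof (cases "\<phi> u \<in> F")
        case True
        have b: "\<psi> u \<in> nbhd V E (c u)" using gu[OF u True] Bf(1)[OF c(1)[OF u]] True by (auto simp: \<psi>_def)
        then have "gdist E u (\<psi> u) \<le> 7"
          using gdist_triangle[OF G u, of "c u" "\<psi> u"] c[OF u] A'(1) by (auto simp: nbhd_def)
        then show ?thesis by simp
      qed (use \<phi>(2)[OF u] in \<open>simp add: \<psi>_def\<close>)
    next
      fix v assume v: "v \<in> (S \<union> B - F) \<inter> VL"
      \<comment> \<open>The new load of \<open>v\<close> is at most the old load of one center
        \<open>w\<close>. For a backup \<open>v\<close>, disjointness of the sets
        \<open>Bf a\<close> determines \<open>a\<close>, and injectivity then determines the failed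
        center; any other \<open>v\<close> has only its original clients.\<close>
      have "\<exists>w\<in>S \<inter> (VL - B). {u \<in> V. \<psi> u = v} \<subseteq> {u \<in> V. \<phi> u = w} \<or> {u \<in> V. \<psi> u = v} = {}"
      proof (cases "\<exists>u\<in>V. \<psi> u = v")
        case True
        then obtain u where u: "u \<in> V" "\<psi> u = v" by blast
        have "\<phi> u' = \<phi> u" if u': "u' \<in> V" "\<psi> u' = v" for u'
        proof (cases "v \<in> B")
          case True
          then have "\<phi> w \<in> F" if "w \<in> V" "\<psi> w = v" for w
            using that \<phi>B[of w] by (auto simp: \<psi>_def split: if_splits)
          with u u' have F: "\<phi> u \<in> F" "\<phi> u' \<in> F" by blast+
          have eq: "g (c u) (\<phi> u) = v" "g (c u') (\<phi> u') = v" using u u' F by (auto simp: \<psi>_def)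
          have cc: "c u = c u'"
            by (rule uniq[OF c(1)[OF u(1)] c(1)[OF u'(1)], of v])
               (use gu[OF u(1) F(1)] gu[OF u'(1) F(2)] eq in auto)
          show ?thesis
          proof (rule inj_onD[OF g(2)[OF c(1)[OF u(1)]]])
            show "g (c u) (\<phi> u') = g (c u) (\<phi> u)" using eq cc by metis
          qed (use F \<phi>B[OF u(1)] \<phi>B[OF u'(1)] in auto)
        next
          case False
          have "\<phi> w = v" if "w \<in> V" "\<psi> w = v" for w
            using that False gu[of w] c(1)[of w] by (auto simp: \<psi>_def B split: if_splits)
          then show ?thesis using u u' by simp
        qed
        then have "{u \<in> V. \<psi> u = v} \<subseteq> {w \<in> V. \<phi> w = \<phi> u}" by blast
        moreover have "\<phi> u \<in> S \<inter> (VL - B)" using \<phi>(1) \<phi>B u by blast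
        ultimately show ?thesis by blast
      next
        case False
        then show ?thesis using ne \<phi>(1) \<phi>B by blast
      qed
      then obtain w where w: "w \<in> S \<inter> (VL - B)" "{u \<in> V. \<psi> u = v} \<subseteq> {u \<in> V. \<phi> u = w}" by blast
      then have "card {u \<in> V. \<psi> u = v} \<le> card {u \<in> V. \<phi> u = w}" using fin by (intro card_mono) auto
      also have "\<dots> \<le> L" using S(3) w unfolding cap_assignment_def by blast
      finally show "card {u \<in> V. \<psi> u = v} \<le> L" .
    next
      fix v assume v: "v \<in> (S \<union> B - F) - VL"
      have "\<psi> u \<in> VL" if "u \<in> V" for u
        using \<phi>B[OF that] gu[OF that] c(1)[OF that] Bf(1) by (auto simp: \<psi>_def)
      then have "{u \<in> V. \<psi> u = v} = {}" using v by blast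
      then show "card {u \<in> V. \<psi> u = v} = 0" by (simp only: card.empty)
    qed
    then show ?thesis
      unfolding \<psi>_def by (rule exI[of _ "\<lambda>u. g (c u) (\<phi> u)"])
  qed
  show ?thesis
    unfolding ft_solution_def
  proof (intro conjI allI impI)
    show "S \<union> B \<subseteq> V" using S(1) BVL VL by blast
    show "cap_assignment V E L VL (max 7 \<beta>) (S \<union> B) \<phi>" using main[of "{}"] by simp
    fix F assume "F \<subseteq> S \<union> B \<and> card F \<le> \<alpha>"
    then obtain g where "cap_assignment V E L VL (max 7 \<beta>) (S \<union> B - F) (\<lambda>u. if \<phi> u \<in> F then g u else \<phi> u)"
      using main by blast
    then show "\<exists>\<psi>. cap_assignment V E L VL (max 7 \<beta>) (S \<union> B - F) \<psi> \<and>
        (\<forall>u\<in>V. \<phi> u \<notin> F \<longrightarrow> \<psi> u = \<phi> u)" by (intro exI conjI) auto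
  qed (rule cardSB)
qed

section \<open>A program for the algorithm\<close>

definition vertices_t :: "tree \<Rightarrow> tree" where
  "vertices_t x = ulen_t (left x)"

definition budget_t :: "tree \<Rightarrow> tree" where
  "budget_t x = left (right x)"

definition cap_t :: "tree \<Rightarrow> tree" where
  "cap_t x = left (right (right x))"

definition alpha_t :: "tree \<Rightarrow> tree" where
  "alpha_t x = right (right (right x))"

definition dist1_t :: "tree \<Rightarrow> tree" where
  "dist1_t x = tab_t (\<lambda>i. tab_t (\<lambda>j. disj_t (eq_t i j) (nth_t (nth_t (left x) i) j)) (vertices_t x)) (vertices_t x)"

definition bool_mult_t :: "tree \<Rightarrow> tree \<Rightarrow> tree \<Rightarrow> tree" where
  "bool_mult_t u X Y = tab_t (\<lambda>i. tab_t (\<lambda>j. ex_t (\<lambda>l. conj_t (nth_t (nth_t X i) l) (nth_t (nth_t Y l) j)) u) u) u"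

text \<open>The Boolean product adds distance bounds, and 6 = 3 + 3 = (2 + 1) + (2 + 1). Vertices
  conflict with 7-independence when they are within distance 6.\<close>

definition dist2_t :: "tree \<Rightarrow> tree" where
  "dist2_t x = bool_mult_t (vertices_t x) (dist1_t x) (dist1_t x)"

definition dist3_t :: "tree \<Rightarrow> tree" where
  "dist3_t x = bool_mult_t (vertices_t x) (dist2_t x) (dist1_t x)"

definition dist6_t :: "tree \<Rightarrow> tree" where
  "dist6_t x = bool_mult_t (vertices_t x) (dist3_t x) (dist3_t x)"

definition insert_t :: "tree \<Rightarrow> tree \<Rightarrow> tree \<Rightarrow> tree" where
  "insert_t u i A = tab_t (\<lambda>j. disj_t (eq_t i j) (nth_t A j)) u"

text \<open>One greedy step, for the vertex \<open>right w\<close>. The distance matrix is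
  recomputed for every test, which a polynomial bound tolerates.\<close>

definition independent_step_t :: "tree \<Rightarrow> tree \<Rightarrow> tree \<Rightarrow> tree" where
  "independent_step_t x w A =
     (if ex_t (\<lambda>j. conj_t (nth_t A j) (nth_t (nth_t (dist6_t x) (right w)) j)) (vertices_t x) = Leaf
      then insert_t (vertices_t x) (right w) A else A)"

definition independent_t :: "tree \<Rightarrow> tree" where
  "independent_t x = loopt (independent_step_t x) (vertices_t x) (tab_t (\<lambda>i. Leaf) (vertices_t x))"

definition candidate_t :: "tree \<Rightarrow> tree \<Rightarrow> tree \<Rightarrow> tree" where
  "candidate_t x a j = conj_t (nth_t (nth_t (dist1_t x) a) j) (nth_t (cap_t x) j)"

text \<open>The remaining count, used as a truth value, is nonzero when \<open>a\<close> has fewer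
  than \<open>\<alpha>\<close> candidates.\<close>

definition too_few_t :: "tree \<Rightarrow> tree" where
  "too_few_t x = ex_t (\<lambda>a. conj_t (nth_t (independent_t x) a)
     (count_down_t (candidate_t x a) (vertices_t x) (alpha_t x))) (vertices_t x)"

text \<open>The backup set of \<open>a\<close> consists of its \<open>\<alpha>\<close> smallest candidates: those \<open>j\<close> with fewer than \<open>\<alpha>\<close>
  candidates below \<open>j\<close>, for which counting down from \<open>\<alpha>\<close> leaves a positive number.\<close>

definition backup_t :: "tree \<Rightarrow> tree" where
  "backup_t x = tab_t (\<lambda>j. ex_t (\<lambda>a. conj_t (nth_t (independent_t x) a)
     (conj_t (candidate_t x a j) (count_down_t (candidate_t x a) j (alpha_t x)))) (vertices_t x)) (vertices_t x)"

definition cap_instance_t :: "tree \<Rightarrow> tree" where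
  "cap_instance_t x = Node (left x) (Node (count_down_t (nth_t (backup_t x)) (vertices_t x) (budget_t x))
     (tab_t (\<lambda>j. conj_t (nth_t (cap_t x) j) (neg_t (nth_t (backup_t x) j))) (vertices_t x)))"

text \<open>\<open>B\<close> is passed along with the instance because it is needed again after the
  call of \<open>ALG\<close>; \<open>Leaf\<close> signals failure before that call.\<close>

definition prepare_t :: "tree \<Rightarrow> tree" where
  "prepare_t x = (if too_few_t x = Leaf then Node (cap_instance_t x) (backup_t x) else Leaf)"

text \<open>The input pairs a successful result of \<open>ALG\<close> with \<open>B\<close>; the
  length of the vector of \<open>B\<close> supplies the number of vertices.\<close>

definition combine_t :: "tree \<Rightarrow> tree" where
  "combine_t z = Node (tab_t (\<lambda>i. disj_t (nth_t (left (left z)) i) (nth_t (right z) i)) (ulen_t (right z)))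
     (right (left z))"

section \<open>Polynomial running time of the components\<close>

lemma ptime_input:
  "ptime f \<Longrightarrow> ptime (\<lambda>x. vertices_t (f x))" "ptime f \<Longrightarrow> ptime (\<lambda>x. budget_t (f x))"
  "ptime f \<Longrightarrow> ptime (\<lambda>x. cap_t (f x))" "ptime f \<Longrightarrow> ptime (\<lambda>x. alpha_t (f x))"
  unfolding vertices_t_def budget_t_def cap_t_def alpha_t_def by (intro ptime_intros; assumption)+

lemma ptime_dist1_t: "ptime f \<Longrightarrow> ptime (\<lambda>x. dist1_t (f x))"
  by (rule ptime_comp[of dist1_t]) (unfold dist1_t_def, intro ptime_intros ptime_input)

text \<open>Below the binders, \<open>u\<close>, \<open>f\<close> and \<open>g\<close> are applied
  to projections of the extended input, hence the compositions.\<close>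

lemma ptime_bool_mult_t:
  assumes "ptime u" "ptime f" "ptime g"
  shows "ptime (\<lambda>x. bool_mult_t (u x) (f x) (g x))"
  unfolding bool_mult_t_def
  by (intro ptime_intros ptime_comp[OF assms(1)] ptime_comp[OF assms(2)] ptime_comp[OF assms(3)] assms)

lemma ptime_dist6_t: "ptime f \<Longrightarrow> ptime (\<lambda>x. dist6_t (f x))"
  by (rule ptime_comp[of dist6_t])
     (unfold dist6_t_def dist3_t_def dist2_t_def, intro ptime_intros ptime_input ptime_dist1_t ptime_bool_mult_t)

text \<open>The vector is rebuilt from normalised bits, so its size does not depend on
  \<open>A\<close>. The bound covers arbitrary trees, as \<open>ptime\<close> quantifies over all
  inputs and not only over encodings.\<close>

lemma size_insert_t: "size (insert_t u i A) \<le> 2 * size u"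
proof -
  have "size (loopt (\<lambda>w a. Node (disj_t (eq_t i (right w)) (nth_t A (right w))) a) u a) \<le> size a + 2 * size u" for a
  proof (induction u arbitrary: a)
    case (Node l r)
    show ?case
      using Node.IH(2)[of "Node (disj_t (eq_t i r) (nth_t A r)) a"] size_disj_t[of "eq_t i r" "nth_t A r"]
      by simp
  qed simp
  from this[of Leaf] show ?thesis by (simp add: insert_t_def tab_t_def)
qed

lemma ptime_independent_t: "ptime f \<Longrightarrow> ptime (\<lambda>x. independent_t (f x))"
proof (rule ptime_comp[of independent_t])
  have "ptime vertices_t" using ptime_input(1)[OF ptime_id] .
  then obtain p where p: "\<And>x. size (vertices_t x) \<le> poly p (size x)" unfolding ptime_def by blast
  show "ptime independent_t"
    unfolding independent_t_def
  proof (rule ptime_loop[where q = "[:2:] * p"])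
    fix x w a :: tree
    have "size (vertices_t x) \<le> poly p (size x + size w)"
      using p[of x] poly_mono_nat[of "size x" "size x + size w" p] by linarith
    then show "size (independent_step_t x w a) \<le> size a + poly ([:2:] * p) (size x + size w)"
      using size_insert_t[of "vertices_t x" "right w" a] by (auto simp: independent_step_t_def)
  qed (unfold independent_step_t_def insert_t_def, (intro ptime_intros ptime_if ptime_input ptime_dist6_t)+)
qed

lemma ptime_candidate_t:
  assumes "ptime f" "ptime g" "ptime h"
  shows "ptime (\<lambda>x. candidate_t (f x) (g x) (h x))"
  unfolding candidate_t_def by (intro ptime_intros ptime_dist1_t ptime_input assms)

lemma ptime_backup_t: "ptime f \<Longrightarrow> ptime (\<lambda>x. backup_t (f x))"
  by (rule ptime_comp[of backup_t])
     (unfold backup_t_def, intro ptime_intros ptime_input ptime_candidate_t ptime_independent_t)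

lemma ptime_prepare_t: "ptime prepare_t"
  unfolding prepare_t_def cap_instance_t_def too_few_t_def
  by (intro ptime_if ptime_intros ptime_input ptime_candidate_t ptime_independent_t ptime_backup_t)

lemma ptime_combine_t: "ptime combine_t"
  unfolding combine_t_def by (intro ptime_intros)

section \<open>Correctness of the components on encodings\<close>

lemma enc_list_cong: "(\<And>i. i < n \<Longrightarrow> f i = g i) \<Longrightarrow> enc_list f [0..<n] = enc_list g [0..<n]"
  unfolding enc_list_def by (intro foldr_cong) auto

lemma enc_list_eq_iff: "enc_list f [0..<n] = enc_list g [0..<n] \<longleftrightarrow> (\<forall>i<n. f i = g i)"
proof
  assume *: "enc_list f [0..<n] = enc_list g [0..<n]"
  show "\<forall>i<n. f i = g i"
  proof (intro allI impI)
    fix i assume "i < n"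
    then show "f i = g i" using arg_cong[OF *, of "\<lambda>t. nth_t t (un i)"] by simp
  qed
qed (auto intro: enc_list_cong)

lemma nth_t_enc_set [simp]: "i < n \<Longrightarrow> nth_t (enc_set n X) (un i) = enc_bool (i \<in> X)"
  by (simp add: enc_set_def)

lemma nth_t_enc_graph [simp]: "i < n \<Longrightarrow> nth_t (enc_graph n R) (un i) = enc_set n (R `` {i})"
  by (simp add: enc_graph_def)

lemma tab_t_enc_set:
  "(\<And>i. i < n \<Longrightarrow> h (un i) = enc_bool (i \<in> X)) \<Longrightarrow> tab_t h (un n) = enc_set n X"
  unfolding tab_t_un enc_set_def by (rule enc_list_cong)

lemma tab_t_enc_graph:
  assumes "\<And>i j. i < n \<Longrightarrow> j < n \<Longrightarrow> h (un i) (un j) = enc_bool ((i, j) \<in> R)"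
  shows "tab_t (\<lambda>i. tab_t (h i) (un n)) (un n) = enc_graph n R"
proof -
  have "tab_t (h (un i)) (un n) = enc_set n (R `` {i})" if "i < n" for i
    by (rule tab_t_enc_set) (use assms that in simp)
  then show ?thesis unfolding tab_t_un[of _ n] enc_graph_def by (intro enc_list_cong) simp
qed

lemma ex_less_iff_bex:
  assumes "A \<subseteq> {..<n :: nat}" "\<And>i. i < n \<Longrightarrow> P i \<longleftrightarrow> i \<in> A \<and> Q i"
  shows "(\<exists>i<n. P i) \<longleftrightarrow> (\<exists>i\<in>A. Q i)"
  using assms by fastforce

definition dist_rel :: "(nat \<times> nat) set \<Rightarrow> nat \<Rightarrow> (nat \<times> nat) set" where
  "dist_rel E r = {(i, j). gdist E i j \<le> r}"

lemma bool_mult_t_dist: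
  assumes "connected_graph {..<n} E"
  shows "bool_mult_t (un n) (enc_graph n (dist_rel E a)) (enc_graph n (dist_rel E b)) = enc_graph n (dist_rel E (a + b))"
  unfolding bool_mult_t_def
proof (rule tab_t_enc_graph)
  fix i j assume ij: "i < n" "j < n"
  have "(\<exists>l<n. gdist E i l \<le> a \<and> gdist E l j \<le> b) \<longleftrightarrow> gdist E i j \<le> a + b"
    using gdist_add_le_iff[OF assms, of i j a b] ij by auto
  moreover have "(\<exists>l<n. conj_t (nth_t (nth_t (enc_graph n (dist_rel E a)) (un i)) (un l))
        (nth_t (nth_t (enc_graph n (dist_rel E b)) (un l)) (un j)) \<noteq> Leaf) \<longleftrightarrow>
      (\<exists>l<n. gdist E i l \<le> a \<and> gdist E l j \<le> b)"
    using ij by (intro ex_cong1) (auto simp: dist_rel_def)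
  ultimately show "ex_t (\<lambda>l. conj_t (nth_t (nth_t (enc_graph n (dist_rel E a)) (un i)) l)
      (nth_t (nth_t (enc_graph n (dist_rel E b)) l) (un j))) (un n) = enc_bool ((i, j) \<in> dist_rel E (a + b))"
    by (simp add: dist_rel_def)
qed

text \<open>The number of smaller elements is an injection of \<open>X\<close> into
  \<open>{..<card X}\<close>, hence a bijection; exactly \<open>\<alpha>\<close> elements have rank
  below \<open>\<alpha>\<close>.\<close>

lemma card_least_elements:
  fixes X :: "nat set"
  assumes "finite X" "\<alpha> \<le> card X"
  shows "card {j \<in> X. card {l \<in> X. l < j} < \<alpha>} = \<alpha>"
proof -
  define rank where "rank j = card {l \<in> X. l < j}" for j
  have lt: "rank i < rank j" if "i \<in> X" "i < j" for i j
    unfolding rank_def using assms(1) that by (intro psubset_card_mono) (simp, force)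
  have inj: "inj_on rank X"
    by (rule inj_onI) (metis lt less_irrefl linorder_neqE_nat)
  have "rank ` X \<subseteq> {..<card X}"
    unfolding rank_def using assms(1) by (auto intro!: psubset_card_mono)
  then have im: "rank ` X = {..<card X}"
    by (intro card_subset_eq) (auto simp: card_image inj)
  have "rank ` {j \<in> X. rank j < \<alpha>} = {..<\<alpha>}"
  proof (intro equalityI subsetI)
    fix m assume "m \<in> {..<\<alpha>}"
    then have "m \<in> rank ` X" using im assms(2) by auto
    with \<open>m \<in> {..<\<alpha>}\<close> show "m \<in> rank ` {j \<in> X. rank j < \<alpha>}" by blast
  qed auto
  then show ?thesis
    using card_image[of rank "{j \<in> X. rank j < \<alpha>}"] inj_on_subset[OF inj, of "{j \<in> X. rank j < \<alpha>}"]
    by (auto simp: rank_def)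
qed

context
  fixes n :: nat and E :: "(nat \<times> nat) set" and k :: nat and VL :: "nat set" and \<alpha> :: nat and x :: tree
  assumes valid: "valid_instance n E VL"
  defines "x \<equiv> enc_ft_instance n E k VL \<alpha>"
begin

lemma connected: "connected_graph {..<n} E"
  using valid by (simp add: valid_instance_def)

lemma input_simps:
  "left x = enc_graph n E" "vertices_t x = un n" "budget_t x = enc_nat k" "cap_t x = enc_set n VL" "alpha_t x = enc_nat \<alpha>"
  by (simp_all add: x_def enc_ft_instance_def vertices_t_def budget_t_def cap_t_def alpha_t_def enc_graph_def)

lemma dist1_t_eq: "dist1_t x = enc_graph n (dist_rel E 1)"
  unfolding dist1_t_def input_simps
  by (rule tab_t_enc_graph) (use gdist_le_1_iff[OF connected] in \<open>simp add: disj_t_def dist_rel_def\<close>)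

lemma dist6_t_eq: "dist6_t x = enc_graph n (dist_rel E 6)"
  unfolding dist6_t_def dist3_t_def dist2_t_def dist1_t_eq input_simps bool_mult_t_dist[OF connected]
  by (simp add: eval_nat_numeral)

lemma independent_step_t_eq:
  assumes "i < n" "A \<subseteq> {..<n}"
  shows "independent_step_t x (un (Suc i)) (enc_set n A) =
    enc_set n (if \<exists>j\<in>A. gdist E i j \<le> 6 then A else insert i A)"
proof -
  have "insert_t (un n) (un i) (enc_set n A) = enc_set n (insert i A)"
    unfolding insert_t_def by (rule tab_t_enc_set) (auto simp: disj_t_def intro: arg_cong[where f = enc_bool])
  moreover have "(\<exists>j<n. conj_t (nth_t (enc_set n A) (un j)) (nth_t (nth_t (enc_graph n (dist_rel E 6)) (un i)) (un j)) \<noteq> Leaf)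
      \<longleftrightarrow> (\<exists>j\<in>A. gdist E i j \<le> 6)"
    by (rule ex_less_iff_bex) (use assms in \<open>simp_all add: dist_rel_def\<close>)
  ultimately show ?thesis
    by (simp add: independent_step_t_def input_simps dist6_t_eq)
qed

text \<open>The invariant of the greedy loop: \<open>A\<close> is independent and covers every
  vertex from \<open>m\<close> on, while those below \<open>m\<close> are still to be visited. At 0
  the cover is complete, so \<open>A\<close> is maximal.\<close>

lemma independent_loop:
  assumes "m \<le> n" "A \<subseteq> {..<n}" "dist_independent E 7 A"
    and "\<And>u. m \<le> u \<Longrightarrow> u < n \<Longrightarrow> \<exists>a\<in>A. gdist E u a \<le> 6"
  shows "\<exists>A'. loopt (independent_step_t x) (un m) (enc_set n A) = enc_set n A' \<and>
    maximal_dist_independent {..<n} E 7 A'"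
  using assms
proof (induction m arbitrary: A)
  case 0
  have "maximal_dist_independent {..<n} E (Suc 6) A"
    by (rule maximal_dist_independentI[OF connected]) (use 0 in auto)
  then show ?case by auto
next
  case (Suc m)
  let ?A = "if \<exists>j\<in>A. gdist E m j \<le> 6 then A else insert m A"
  have "\<exists>A'. loopt (independent_step_t x) (un m) (enc_set n ?A) = enc_set n A' \<and>
      maximal_dist_independent {..<n} E 7 A'"
  proof (rule Suc.IH)
    show "dist_independent E 7 ?A"
      using Suc.prems(3) gdist_commute[OF connected, of m] by (auto simp: dist_independent_def not_le Suc_le_eq)
    fix u assume "m \<le> u" "u < n"
    then show "\<exists>a\<in>?A. gdist E u a \<le> 6"
      using Suc.prems(4)[of u] by (cases "u = m") auto
  qed (use Suc.prems in auto)
  then show ?case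
    using independent_step_t_eq[of m A] Suc.prems by simp
qed

lemma independent_t_eq:
  obtains A where "independent_t x = enc_set n A" "maximal_dist_independent {..<n} E 7 A"
proof -
  have "tab_t (\<lambda>i. Leaf) (un n) = enc_set n {}"
    by (rule tab_t_enc_set) (simp add: enc_bool_def)
  then show ?thesis
    using independent_loop[of n "{}"] that
    by (auto simp: independent_t_def input_simps dist_independent_def)
qed

lemma candidate_t_eq:
  "a < n \<Longrightarrow> j < n \<Longrightarrow> candidate_t x (un a) (un j) = enc_bool (j \<in> nbhd {..<n} E a \<inter> VL)"
  by (simp add: candidate_t_def dist1_t_eq input_simps conj_t_def dist_rel_def nbhd_def)

text \<open>At \<open>j = n\<close> all candidates are counted, which decides whether there are too
  few; at a vertex \<open>j\<close> only those strictly below, which gives its rank.\<close>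

lemma count_candidates:
  assumes "a < n" "j \<le> n"
  shows "count_down_t (candidate_t x (un a)) (un j) (alpha_t x) =
    enc_nat (\<alpha> - card {l \<in> nbhd {..<n} E a \<inter> VL. l < j})"
proof -
  have "{l. l < j \<and> candidate_t x (un a) (un l) \<noteq> Leaf} = {l \<in> nbhd {..<n} E a \<inter> VL. l < j}"
    using assms by (auto simp: candidate_t_eq)
  then show ?thesis by (simp add: input_simps)
qed

lemma prepare_t_eq:
  obtains A where "maximal_dist_independent {..<n} E 7 A" "\<exists>a\<in>A. card (nbhd {..<n} E a \<inter> VL) < \<alpha>" "prepare_t x = Leaf"
  | A Bf B where "maximal_dist_independent {..<n} E 7 A" "\<not> (\<exists>a\<in>A. card (nbhd {..<n} E a \<inter> VL) < \<alpha>)"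
    "\<forall>a\<in>A. Bf a \<subseteq> nbhd {..<n} E a \<inter> VL \<and> card (Bf a) = \<alpha>" "B = (\<Union>a\<in>A. Bf a)"
    "prepare_t x = Node (enc_cap_instance n E (k - card B) (VL - B)) (enc_set n B)"
proof -
  obtain A where A: "independent_t x = enc_set n A" "maximal_dist_independent {..<n} E 7 A"
    by (rule independent_t_eq)
  have An: "A \<subseteq> {..<n}" using A(2) by (simp add: maximal_dist_independent_def)
  let ?X = "\<lambda>a. nbhd {..<n} E a \<inter> VL"
  have X: "{l \<in> ?X a. l < n} = ?X a" "finite (?X a)" for a by (auto simp: nbhd_def)
  have count: "count_down_t (candidate_t x (un a)) (un n) (alpha_t x) = enc_nat (\<alpha> - card (?X a))" if "a < n" for a
    using count_candidates[OF that order.refl] unfolding X(1) .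
  have "(\<exists>a<n. conj_t (nth_t (independent_t x) (un a)) (count_down_t (candidate_t x (un a)) (un n) (alpha_t x)) \<noteq> Leaf)
      \<longleftrightarrow> (\<exists>a\<in>A. card (?X a) < \<alpha>)"
    by (rule ex_less_iff_bex[OF An]) (simp add: A(1) count not_le)
  then have few: "too_few_t x = enc_bool (\<exists>a\<in>A. card (?X a) < \<alpha>)"
    by (simp add: too_few_t_def input_simps)
  define Bf where "Bf a = {j \<in> ?X a. card {l \<in> ?X a. l < j} < \<alpha>}" for a
  define B where "B = (\<Union>a\<in>A. Bf a)"
  have Bn: "B \<subseteq> {..<n}" by (auto simp: B_def Bf_def nbhd_def)
  have backup: "backup_t x = enc_set n B"
    unfolding backup_t_def input_simps(2)
  proof (rule tab_t_enc_set)
    fix j assume j: "j < n"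
    have "(\<exists>a<n. conj_t (nth_t (independent_t x) (un a)) (conj_t (candidate_t x (un a) (un j))
        (count_down_t (candidate_t x (un a)) (un j) (alpha_t x))) \<noteq> Leaf) \<longleftrightarrow> (\<exists>a\<in>A. j \<in> Bf a)"
      by (rule ex_less_iff_bex[OF An]) (use j in \<open>simp add: A(1) count_candidates candidate_t_eq Bf_def not_le conj_ac\<close>)
    then show "ex_t (\<lambda>a. conj_t (nth_t (independent_t x) a) (conj_t (candidate_t x a (un j))
        (count_down_t (candidate_t x a) (un j) (alpha_t x)))) (un n) = enc_bool (j \<in> B)"
      by (simp add: B_def)
  qed
  have "{i. i < n \<and> nth_t (enc_set n B) (un i) \<noteq> Leaf} = B" using Bn by auto
  moreover have "tab_t (\<lambda>j. conj_t (nth_t (enc_set n VL) j) (neg_t (nth_t (enc_set n B) j))) (un n) = enc_set n (VL - B)"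
    by (rule tab_t_enc_set) (simp add: conj_t_def)
  ultimately have inst: "cap_instance_t x = enc_cap_instance n E (k - card B) (VL - B)"
    by (simp add: cap_instance_t_def input_simps backup enc_cap_instance_def)
  show ?thesis
  proof (cases "\<exists>a\<in>A. card (?X a) < \<alpha>")
    case True
    then show ?thesis using that(1)[OF A(2)] few by (simp add: prepare_t_def)
  next
    case False
    have "card (Bf a) = \<alpha>" if "a \<in> A" for a
      unfolding Bf_def by (rule card_least_elements[OF X(2)]) (use False that in \<open>simp add: not_less\<close>)
    then have "\<forall>a\<in>A. Bf a \<subseteq> ?X a \<and> card (Bf a) = \<alpha>" by (auto simp: Bf_def)
    then show ?thesis using that(2)[OF A(2) False _ B_def] few False inst backup by (simp add: prepare_t_def)
  qed
qed

end

section \<open>Results, their encodings and the guarantee\<close>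

lemma combine_t_eq:
  "combine_t (Node (enc_result n (Some (S, \<phi>))) (enc_set n B)) = enc_result n (Some (S \<union> B, \<phi>))"
proof -
  have "ulen_t (enc_set n B) = un n" by (simp add: enc_set_def)
  moreover have "tab_t (\<lambda>i. disj_t (nth_t (enc_set n S) i) (nth_t (enc_set n B) i)) (un n) = enc_set n (S \<union> B)"
    by (rule tab_t_enc_set) (simp add: disj_t_def)
  ultimately show ?thesis by (simp add: combine_t_def enc_result_def)
qed

lemma enc_nat_inject: "enc_nat a = enc_nat b \<longleftrightarrow> a = b"
proof
  show "enc_nat a = enc_nat b \<Longrightarrow> a = b"
  proof (induction a arbitrary: b rule: less_induct)
    case (less a)
    show ?case
    proof (cases "a = 0 \<or> b = 0")
      case True
      then show ?thesis using less.prems enc_nat_eq_Leaf by metis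
    next
      case False
      then have "enc_bool (odd a) = enc_bool (odd b)" "enc_nat (a div 2) = enc_nat (b div 2)"
        using less.prems by (simp_all add: enc_nat.simps[of a] enc_nat.simps[of b])
      then have "odd a \<longleftrightarrow> odd b" "a div 2 = b div 2"
        using less.IH[of "a div 2"] False by (auto simp: enc_bool_def split: if_splits)
      then show ?thesis by (metis div_mult_mod_eq even_iff_mod_2_eq_zero not_mod_2_eq_1_eq_0)
    qed
  qed
qed simp

lemma enc_set_inject: "X \<subseteq> {..<n} \<Longrightarrow> Y \<subseteq> {..<n} \<Longrightarrow> enc_set n X = enc_set n Y \<longleftrightarrow> X = Y"
  unfolding enc_set_def enc_list_eq_iff by (auto simp: enc_bool_def split: if_splits)

lemma cap_solution_cong:
  assumes "\<And>u. u \<in> V \<Longrightarrow> \<phi> u = \<phi>' u"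
  shows "cap_solution V E L k VL r S \<phi> \<longleftrightarrow> cap_solution V E L k VL r S \<phi>'"
proof -
  have "{u \<in> V. \<phi> u = v} = {u \<in> V. \<phi>' u = v}" for v using assms by auto
  then show ?thesis using assms by (simp add: cap_solution_def cap_assignment_def)
qed

text \<open>The definition promises only some good returned result. As programs are deterministic
  and encodings injective, any other returned result has the same centers and the same assignment on
  vertices.\<close>

lemma cap_approximation_returns:
  assumes "cap_approximation L \<beta> ALG" "valid_instance n E VL" "returns ALG (enc_cap_instance n E k VL) n res"
  shows "case res of None \<Rightarrow> \<not> (\<exists>S \<phi>. cap_solution {..<n} E L k VL 1 S \<phi>)
    | Some (S, \<phi>) \<Rightarrow> cap_solution {..<n} E L k VL \<beta> S \<phi>"
proof -
  obtain res' where res': "returns ALG (enc_cap_instance n E k VL) n res'"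
    "case res' of None \<Rightarrow> \<not> (\<exists>S \<phi>. cap_solution {..<n} E L k VL 1 S \<phi>)
      | Some (S, \<phi>) \<Rightarrow> cap_solution {..<n} E L k VL \<beta> S \<phi>"
    using assms unfolding cap_approximation_def by blast
  then have eq: "enc_result n res = enc_result n res'"
    using assms(3) run_deterministic unfolding returns_def by blast
  show ?thesis
  proof (cases res)
    case None
    then show ?thesis using eq res'(2) by (cases res') (auto simp: enc_result_def)
  next
    case (Some p)
    then obtain S \<phi> where res: "res = Some (S, \<phi>)" by (cases p) auto
    then obtain S' \<phi>' where res'_eq: "res' = Some (S', \<phi>')"
      using eq by (cases res') (auto simp: enc_result_def)
    have "S = S'" "\<forall>u<n. \<phi> u = \<phi>' u"
      using eq assms(3) res'(1) enc_set_inject[of S n S']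
      by (auto simp: res res'_eq enc_result_def returns_def enc_list_eq_iff enc_nat_inject)
    then show ?thesis using res'(2) cap_solution_cong[of "{..<n}" \<phi> \<phi>'] by (simp add: res res'_eq)
  qed
qed

lemma ft_approximation_of_implementation:
  assumes ALG: "cap_approximation L \<beta> ALG" and P: "implements_algorithm1 ALG P" "polynomial_time P ft_inputs"
  shows "ft_approximation L (max 7 \<beta>) P"
  unfolding ft_approximation_def
proof (intro conjI allI impI P(2))
  fix n E k VL \<alpha>
  assume valid: "valid_instance n E VL"
  then have G: "connected_graph {..<n} E" and VL: "VL \<subseteq> {..<n}" by (auto simp: valid_instance_def)
  obtain out where out: "returns P (enc_ft_instance n E k VL \<alpha>) n out" "algorithm1 ALG n E k VL \<alpha> out"
    using P(1) valid unfolding implements_algorithm1_def by blast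
  obtain A where A: "maximal_dist_independent {..<n} E 7 A"
    and alg: "if \<exists>a\<in>A. card (nbhd {..<n} E a \<inter> VL) < \<alpha> then out = None
         else \<exists>Bf B res.
           (\<forall>a\<in>A. Bf a \<subseteq> nbhd {..<n} E a \<inter> VL \<and> card (Bf a) = \<alpha>) \<and>
           B = (\<Union>a\<in>A. Bf a) \<and>
           returns ALG (enc_cap_instance n E (k - card B) (VL - B)) n res \<and>
           out = (case res of None \<Rightarrow> None | Some (S, \<phi>) \<Rightarrow> Some (S \<union> B, \<phi>))"
    using out(2) unfolding algorithm1_def by blast
  have A': "A \<subseteq> {..<n}" "dist_independent E 7 A" using A by (auto simp: maximal_dist_independent_def)
  have "case out of None \<Rightarrow> \<not> (\<exists>S \<phi>. ft_solution {..<n} E L k VL \<alpha> 1 S \<phi>)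
      | Some (S, \<phi>) \<Rightarrow> ft_solution {..<n} E L k VL \<alpha> (max 7 \<beta>) S \<phi>"
  proof (cases "\<exists>a\<in>A. card (nbhd {..<n} E a \<inter> VL) < \<alpha>")
    \<comment> \<open>Failure without a call of \<open>ALG\<close> is correct, since a distance-1
      solution needs more than \<open>\<alpha>\<close> centers of \<open>VL\<close> in each closed
      neighbourhood.\<close>
    case True
    then obtain a where a: "a \<in> A" "card (nbhd {..<n} E a \<inter> VL) < \<alpha>" by blast
    have "\<not> ft_solution {..<n} E L k VL \<alpha> 1 S \<phi>" for S \<phi>
    proof
      assume "ft_solution {..<n} E L k VL \<alpha> 1 S \<phi>"
      then have "\<alpha> < card (nbhd {..<n} E a \<inter> VL \<inter> S)"
        using ft_solution_many_neighbours[of "{..<n}"] a(1) A'(1) by blast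
      also have "\<dots> \<le> card (nbhd {..<n} E a \<inter> VL)" by (intro card_mono) (auto simp: nbhd_def)
      finally show False using a(2) by simp
    qed
    then show ?thesis using alg True by simp
  next
    case False
    then obtain Bf B res where Bf: "\<forall>a\<in>A. Bf a \<subseteq> nbhd {..<n} E a \<inter> VL \<and> card (Bf a) = \<alpha>"
      and B: "B = (\<Union>a\<in>A. Bf a)"
      and res: "returns ALG (enc_cap_instance n E (k - card B) (VL - B)) n res"
      and out_eq: "out = (case res of None \<Rightarrow> None | Some (S, \<phi>) \<Rightarrow> Some (S \<union> B, \<phi>))"
      using alg by auto
    have "valid_instance n E (VL - B)" using valid by (auto simp: valid_instance_def)
    note sol = cap_approximation_returns[OF ALG this res]
    show ?thesis
    proof (cases res)
      case None
      have "\<not> ft_solution {..<n} E L k VL \<alpha> 1 S \<phi>" for S \<phi>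
      proof
        assume "ft_solution {..<n} E L k VL \<alpha> 1 S \<phi>"
        from cap_solution_of_ft_solution[OF G this A' _ _ B] Bf None sol show False by simp
      qed
      then show ?thesis using None out_eq by simp
    next
      case (Some p)
      then obtain S \<phi> where p: "res = Some (S, \<phi>)" by (cases p) auto
      then have "ft_solution {..<n} E L k VL \<alpha> (max 7 \<beta>) (S \<union> B) \<phi>"
        using ft_solution_of_cap_solution[OF G VL A _ _ B] Bf sol by simp
      then show ?thesis using p out_eq by simp
    qed
  qed
  with out(1) show "\<exists>res. returns P (enc_ft_instance n E k VL \<alpha>) n res \<and>
      (case res of None \<Rightarrow> \<not> (\<exists>S \<phi>. ft_solution {..<n} E L k VL \<alpha> 1 S \<phi>)
       | Some (S, \<phi>) \<Rightarrow> ft_solution {..<n} E L k VL \<alpha> (max 7 \<beta>) S \<phi>)" by blast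
qed

section \<open>The complete program and its running time\<close>

lemma size_enc_nat: "size (enc_nat m) \<le> 2 * m"
proof (induction m rule: less_induct)
  case (less m)
  show ?case
  proof (cases "m = 0")
    case False
    have "size (enc_nat m) = 1 + size (enc_bool (odd m)) + size (enc_nat (m div 2))"
      using False by (subst enc_nat.simps) simp
    moreover have "size (enc_nat (m div 2)) \<le> 2 * (m div 2)" using less False by simp
    moreover have "size (enc_bool (odd m)) = m mod 2" by (auto simp: enc_bool_def odd_iff_mod_2_eq_one)
    ultimately show ?thesis using False by presburger
  qed simp
qed

lemma size_enc_list:
  assumes "\<And>x. x \<in> set xs \<Longrightarrow> size (f x) \<le> c"
  shows "size (enc_list f xs) \<le> length xs * (c + 1)"
  using assms
proof (induction xs)
  case (Cons a xs)
  then have "size (enc_list f xs) \<le> length xs * (c + 1)" "size (f a) \<le> c" by auto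
  then show ?case by simp
qed simp

lemma length_le_size_enc_list: "length xs \<le> size (enc_list f xs)"
  by (induction xs) auto

lemma implementation_exists:
  assumes ALG: "cap_approximation L \<beta> ALG"
  shows "\<exists>P. implements_algorithm1 ALG P \<and> polynomial_time P ft_inputs"
proof -
  obtain c1 p1 where c1: "\<And>x. \<exists>t. run c1 x t (prepare_t x) \<and> t \<le> poly p1 (size x)"
    "\<And>x. size (prepare_t x) \<le> poly p1 (size x)"
    using ptime_prepare_t unfolding ptime_def by blast
  obtain c2 p2 where c2: "\<And>x. \<exists>t. run c2 x t (combine_t x) \<and> t \<le> poly p2 (size x)"
    using ptime_combine_t unfolding ptime_def by blast
  obtain p where p: "\<forall>x\<in>cap_inputs. \<exists>t y. run ALG x t y \<and> t \<le> poly p (size x)"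
    using ALG unfolding cap_approximation_def polynomial_time_def by blast
  \<comment> \<open>Variable 1 holds the prepared instance together with \<open>B\<close>, variable
    2 the result of \<open>ALG\<close>.\<close>
  define body where "body = Cond (EVar 2) (Call 0 c2 (ENode (EVar 2) (ERight (EVar 1)))) (Assign 0 ELeaf)"
  define P where "P = Seq (Call 1 c1 (EVar 0))
    (Cond (EVar 1) (Seq (Call 2 ALG (ELeft (EVar 1))) body) (Assign 0 ELeaf))"
  \<comment> \<open>The summands pay for the preparation, for \<open>ALG\<close> on an instance of
    size at most \<open>poly p1\<close>, for the combination of an output of size quadratic in the
    input with \<open>B\<close>, and for the control steps.\<close>
  define T where "T = p1 + pcompose p p1 + pcompose p2 ([:0, 3, 2:] + p1 + [:2:]) + [:6:]"
  have T: "poly T N = poly p1 N + poly p (poly p1 N) + poly p2 (N * (3 + N * 2) + poly p1 N + 2) + 6" for N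
    unfolding T_def by (simp only: poly_add poly_pcompose poly_pCons poly_0 mult_zero_right add_0_right add_0_left)
  have main: "\<exists>t out. run P (enc_ft_instance n E k VL \<alpha>) t (enc_result n out) \<and>
      (case out of None \<Rightarrow> True | Some (S, \<phi>) \<Rightarrow> S \<subseteq> {..<n}) \<and> algorithm1 ALG n E k VL \<alpha> out \<and>
      t \<le> poly T (size (enc_ft_instance n E k VL \<alpha>))"
    if valid: "valid_instance n E VL" for n E k VL \<alpha>
  proof -
    define x where "x = enc_ft_instance n E k VL \<alpha>"
    have nx: "n \<le> size x"
      using length_le_size_enc_list[of "[0..<n]"] by (simp add: x_def enc_ft_instance_def enc_graph_def trans_le_add1 le_SucI)
    let ?s = "init_store x"
    obtain t1 where t1: "run c1 x t1 (prepare_t x)" "t1 \<le> poly p1 (size x)" using c1 by blast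
    have 1: "exec (Call 1 c1 (EVar 0)) ?s (t1 + 1) (?s(1 := prepare_t x))"
      by (rule exec_Call_run) (simp add: t1)
    let ?s1 = "?s(1 := prepare_t x)"
    from valid show ?thesis
    proof (rule prepare_t_eq[where k = k and \<alpha> = \<alpha>])
      fix A assume A: "maximal_dist_independent {..<n} E 7 A" "\<exists>a\<in>A. card (nbhd {..<n} E a \<inter> VL) < \<alpha>"
        and "prepare_t (enc_ft_instance n E k VL \<alpha>) = Leaf"
      then have pre: "prepare_t x = Leaf" by (simp add: x_def)
      have 2: "exec (Assign 0 ELeaf) ?s1 1 (?s1(0 := Leaf))"
        using exec.Assign[of 0 ELeaf ?s1] by simp
      have "exec P ?s (t1 + 1 + (1 + 1)) (?s1(0 := Leaf))"
        unfolding P_def by (rule exec.Seq[OF 1 exec.CondFalse[OF _ 2]]) (simp add: pre)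
      then have "run P x (t1 + 1 + (1 + 1)) (enc_result n None)"
        unfolding run_def enc_result_def by force
      moreover have "algorithm1 ALG n E k VL \<alpha> None" unfolding algorithm1_def using A by auto
      moreover have "t1 + 1 + (1 + 1) \<le> poly T (size x)" using t1(2) unfolding T by linarith
      ultimately show ?thesis unfolding x_def[symmetric]
        by (intro exI[of _ "t1 + 1 + (1 + 1)"] exI[of _ None]) simp
    next
      fix A Bf B
      assume A: "maximal_dist_independent {..<n} E 7 A" "\<not> (\<exists>a\<in>A. card (nbhd {..<n} E a \<inter> VL) < \<alpha>)"
        and Bf: "\<forall>a\<in>A. Bf a \<subseteq> nbhd {..<n} E a \<inter> VL \<and> card (Bf a) = \<alpha>" and B: "B = (\<Union>a\<in>A. Bf a)"
        and "prepare_t (enc_ft_instance n E k VL \<alpha>) =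
          Node (enc_cap_instance n E (k - card B) (VL - B)) (enc_set n B)"
      then have pre: "prepare_t x = Node (enc_cap_instance n E (k - card B) (VL - B)) (enc_set n B)"
        by (simp add: x_def)
      let ?y = "enc_cap_instance n E (k - card B) (VL - B)"
      have valid': "valid_instance n E (VL - B)" using valid by (auto simp: valid_instance_def)
      then obtain res where res: "returns ALG ?y n res" using ALG unfolding cap_approximation_def by blast
      define out where "out = (case res of None \<Rightarrow> None | Some (S, \<phi>) \<Rightarrow> Some (S \<union> B, \<phi>))"
      have alg: "algorithm1 ALG n E k VL \<alpha> out"
        unfolding algorithm1_def
        by (rule exI[of _ A], rule conjI[OF A(1)], subst if_not_P[OF A(2)],
            rule exI[of _ Bf], rule exI[of _ B], rule exI[of _ res], intro conjI Bf B res out_def)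
      have Bn: "B \<subseteq> {..<n}" using Bf B by (auto simp: nbhd_def)
      have "?y \<in> cap_inputs" using valid' unfolding cap_inputs_def by blast
      then obtain t2 where t2: "run ALG ?y t2 (enc_result n res)" "t2 \<le> poly p (size ?y)"
      proof -
        obtain u z where u: "run ALG ?y u z" "u \<le> poly p (size ?y)" using p \<open>?y \<in> cap_inputs\<close> by blast
        moreover obtain t where "run ALG ?y t (enc_result n res)" using res unfolding returns_def by blast
        ultimately have "z = enc_result n res" using run_deterministic by blast
        then show ?thesis using u that by blast
      qed
      have "size ?y \<le> poly p1 (size x)" using c1(2)[of x] by (simp add: pre)
      then have t2': "t2 \<le> poly p (poly p1 (size x))"
        using t2(2) poly_mono_nat[of "size ?y" "poly p1 (size x)" p] by linarith
      let ?s2 = "?s1(2 := enc_result n res)"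
      have 2: "exec (Call 2 ALG (ELeft (EVar 1))) ?s1 (t2 + 1) ?s2"
        by (rule exec_Call_run) (simp add: t2 pre)
      have "\<exists>t3. exec body ?s2 t3 (?s2(0 := enc_result n out)) \<and>
          t3 \<le> poly p2 (size x * (3 + size x * 2) + poly p1 (size x) + 2) + 2"
      proof (cases res)
        case None
        have 3: "exec (Assign 0 ELeaf) ?s2 1 (?s2(0 := Leaf))"
          using exec.Assign[of 0 ELeaf ?s2] by simp
        have "exec body ?s2 (1 + 1) (?s2(0 := Leaf))"
          unfolding body_def by (rule exec.CondFalse[OF _ 3]) (simp add: None enc_result_def)
        then show ?thesis using None by (intro exI[of _ "1 + 1"]) (simp add: out_def enc_result_def)
      next
        case (Some q)
        then obtain S \<phi> where q: "res = Some (S, \<phi>)" by (cases q) auto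
        let ?z = "Node (enc_result n res) (enc_set n B)"
        have out: "combine_t ?z = enc_result n out" using q by (simp add: combine_t_eq out_def)
        obtain t3 where t3: "run c2 ?z t3 (enc_result n out)" "t3 \<le> poly p2 (size ?z)"
          using c2[of ?z] out by auto
        have 3: "exec (Call 0 c2 (ENode (EVar 2) (ERight (EVar 1)))) ?s2 (t3 + 1) (?s2(0 := enc_result n out))"
          by (rule exec_Call_run) (simp add: t3 pre)
        have "exec body ?s2 (t3 + 1 + 1) (?s2(0 := enc_result n out))"
          unfolding body_def by (rule exec.CondTrue[OF _ 3]) (simp add: q enc_result_def)
        \<comment> \<open>The running time of \<open>ALG\<close> does not bound the size of its
          output polynomially, since \<open>ENode\<close> shares subtrees. The guarantee does: the
          assignment takes values below \<open>n\<close>, so its encoding has size at most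
          \<open>n * (2 * n + 1)\<close>.\<close>
        moreover have "size ?z \<le> size x * (3 + size x * 2) + poly p1 (size x) + 2"
        proof -
          have "cap_solution {..<n} E L (k - card B) (VL - B) \<beta> S \<phi>"
            using cap_approximation_returns[OF ALG valid' res] q by simp
          then have "\<phi> u < n" if "u < n" for u
            using that unfolding cap_solution_def cap_assignment_def by blast
          then have "size (enc_nat (\<phi> u)) \<le> 2 * n" if "u < n" for u
            using size_enc_nat[of "\<phi> u"] that by (meson less_imp_le mult_le_mono2 order.trans)
          then have "size (enc_list (\<lambda>u. enc_nat (\<phi> u)) [0..<n]) \<le> n * (2 * n + 1)"
            using size_enc_list[of "[0..<n]" "\<lambda>u. enc_nat (\<phi> u)" "2 * n"] by simp
          moreover have "size (enc_set n S) \<le> n * 2"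
            using size_enc_list[of "[0..<n]" "\<lambda>i. enc_bool (i \<in> S)" 1] by (simp add: enc_set_def)
          moreover have "size (enc_set n B) \<le> poly p1 (size x)" using c1(2)[of x] by (simp add: pre)
          moreover have "n * (2 * n + 3) \<le> size x * (3 + size x * 2)" using nx by (intro mult_le_mono) auto
          ultimately show ?thesis by (simp add: q enc_result_def algebra_simps)
        qed
        then have "t3 \<le> poly p2 (size x * (3 + size x * 2) + poly p1 (size x) + 2)"
          by (rule order.trans[OF t3(2) poly_mono_nat])
        ultimately show ?thesis by (intro exI[of _ "t3 + 1 + 1"]) auto
      qed
      then obtain t3 where 3: "exec body ?s2 t3 (?s2(0 := enc_result n out))"
        "t3 \<le> poly p2 (size x * (3 + size x * 2) + poly p1 (size x) + 2) + 2" by blast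
      have "exec P ?s (t1 + 1 + (t2 + 1 + t3 + 1)) (?s2(0 := enc_result n out))"
        unfolding P_def
        by (rule exec.Seq[OF 1 exec.CondTrue[OF _ exec.Seq[OF 2 3(1)]]]) (simp add: pre)
      then have "run P x (t1 + 1 + (t2 + 1 + t3 + 1)) (enc_result n out)"
        unfolding run_def by force
      moreover have "case out of None \<Rightarrow> True | Some (S, \<phi>) \<Rightarrow> S \<subseteq> {..<n}"
        using res Bn by (auto simp: out_def returns_def split: option.splits)
      moreover have "t1 + 1 + (t2 + 1 + t3 + 1) \<le> poly T (size x)"
        using t1(2) t2' 3(2) unfolding T by linarith
      ultimately show ?thesis using alg unfolding x_def[symmetric] by blast
    qed
  qed
  show ?thesis
  proof (intro exI conjI)
    show "implements_algorithm1 ALG P"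
      unfolding implements_algorithm1_def returns_def
    proof (intro allI impI)
      fix n E k VL \<alpha>
      assume "valid_instance n E VL"
      from main[OF this, of k \<alpha>]
      show "\<exists>out. ((\<exists>t. run P (enc_ft_instance n E k VL \<alpha>) t (enc_result n out)) \<and>
          (case out of None \<Rightarrow> True | Some (S, \<phi>) \<Rightarrow> S \<subseteq> {..<n})) \<and> algorithm1 ALG n E k VL \<alpha> out" by blast
    qed
    show "polynomial_time P ft_inputs"
      unfolding polynomial_time_def
    proof (rule exI[of _ T], rule ballI)
      fix x assume "x \<in> ft_inputs"
      then obtain n E k VL \<alpha> where "x = enc_ft_instance n E k VL \<alpha>" "valid_instance n E VL"
        unfolding ft_inputs_def by blast
      then show "\<exists>t y. run P x t y \<and> t \<le> poly T (size x)" using main by blast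
    qed
  qed
qed

theorem theorem1:
  fixes L :: nat and \<beta> :: real and ALG :: com
  assumes "cap_approximation L \<beta> ALG"
  shows "(\<exists>P. implements_algorithm1 ALG P \<and> polynomial_time P ft_inputs) \<and>
         (\<forall>P. implements_algorithm1 ALG P \<and> polynomial_time P ft_inputs \<longrightarrow>
              ft_approximation L (max 7 \<beta>) P)"
  using implementation_exists[OF assms] ft_approximation_of_implementation[OF assms] by blast

end
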